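(* There exists an absolute constant $C>0$ such that for all integers $k\geq 2$ and $n\geq Ck\log k$, \[ \frac{1}{C\log^2 k}\, k^{1/4}\leq M_k(n)^{k/n}\leq C k^{1/4}. \]
   Context: Words are finite sequences over the alphabet $[k]=\{1,\dots,k\}$. For words $v\in[k]^m$ and $w\in[k]^n$, a map from $v$ to $w$ is a strictly increasing function $f\colon[m]\to[n]$ with $v[i]=w[f(i)]$ for all $i$; $M(v,w)$ denotes the number of such maps (the number of occurrences of $v$ as a subsequence of $w$). Let $M(w)=\max_v M(v,w)$, the maximum over all words $v$ over $[k]$, and $M_k(n)=\min_{w\in[k]^n} M(w)$. *)

theory Defs
  imports Complex_Main "HOL-Library.FuncSet"
begin

definition words :: "nat \<Rightarrow> nat list set" where
  "words k = lists {1..k}"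

definition words_of_length :: "nat \<Rightarrow> nat \<Rightarrow> nat list set" where
  "words_of_length k n = {w \<in> words k. length w = n}"

text \<open>Positions are numbered from 0, as in list indexing. Maps are taken extensional (undefined
  outside the positions of \<open>v\<close>), so that distinct maps differ at some position of \<open>v\<close> and
  cardinality counts them correctly.\<close>

definition word_maps :: "nat list \<Rightarrow> nat list \<Rightarrow> (nat \<Rightarrow> nat) set" where
  "word_maps v w =
     {f \<in> {..<length v} \<rightarrow>\<^sub>E {..<length w}.
        strict_mono_on {..<length v} f \<and> (\<forall>i<length v. v ! i = w ! f i)}"

definition num_maps :: "nat list \<Rightarrow> nat list \<Rightarrow> nat" where
  "num_maps v w = card (word_maps v w)"

text \<open>\<open>Max\<close> and \<open>Min\<close> are meaningful only on finite nonempty sets. There are infinitely many words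
  \<open>v\<close>, but only finitely many values \<open>num_maps v w\<close>; see the lemmas below.\<close>

definition max_maps :: "nat \<Rightarrow> nat list \<Rightarrow> nat" where
  "max_maps k w = Max ((\<lambda>v. num_maps v w) ` words k)"

definition min_max_maps :: "nat \<Rightarrow> nat \<Rightarrow> nat" where
  "min_max_maps k n = Min (max_maps k ` words_of_length k n)"

lemma words_of_length_eq: "words_of_length k n = {w. set w \<subseteq> {1..k} \<and> length w = n}"
  by (auto simp: words_of_length_def words_def in_lists_conv_set)

lemma finite_words_of_length: "finite (words_of_length k n)"
  unfolding words_of_length_eq by (rule finite_lists_length_eq) simp

lemma words_of_length_nonempty:
  assumes "k \<ge> 1"
  shows "words_of_length k n \<noteq> {}"
proof -
  have "replicate n 1 \<in> words_of_length k n"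
    using assms by (auto simp: words_of_length_eq)
  then show ?thesis by blast
qed

lemma num_maps_eq_0:
  assumes "length v > length w"
  shows "num_maps v w = 0"
proof -
  have False if f: "f \<in> word_maps v w" for f
  proof -
    have "inj_on f {..<length v}"
      using f by (auto simp: word_maps_def intro: strict_mono_on_imp_inj_on)
    moreover have "f ` {..<length v} \<subseteq> {..<length w}"
      using f by (auto simp: word_maps_def)
    ultimately have "card {..<length v} \<le> card {..<length w}"
      by (meson card_inj_on_le finite_lessThan)
    then show False using assms by simp
  qed
  then have "word_maps v w = {}" by blast
  then show ?thesis by (simp add: num_maps_def)
qed

lemma finite_num_maps_image: "finite ((\<lambda>v. num_maps v w) ` words k)"
proof (rule finite_subset)
  show "(\<lambda>v. num_maps v w) ` words k \<subseteq>
      insert 0 ((\<lambda>v. num_maps v w) ` (\<Union>m\<le>length w. words_of_length k m))"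
    using num_maps_eq_0[of w] by (force simp: words_of_length_def not_le)
  show "finite (insert 0 ((\<lambda>v. num_maps v w) ` (\<Union>m\<le>length w. words_of_length k m)))"
    by (simp add: finite_words_of_length)
qed

lemma words_nonempty: "words k \<noteq> {}"
  by (auto simp: words_def)

end

theory Submission
  imports Defs
begin

text \<open>Lower bound. Let \<open>W i\<close> be the logarithm of the largest number of maps into the prefix of length
  \<open>i\<close>. Consider triples of consecutive occurrences of a letter and group them by the cells, of length
  about \<open>k / ln k\<close>, containing their three positions. In a group of \<open>M\<close> triples the three orders have
  pairwise common increasing subsequences whose lengths multiply to at least \<open>M\<close>, and a common
  subsequence of length \<open>a\<close> occurring twice in an interval makes \<open>W\<close> grow by \<open>ln a\<close> across it. Summing
  over all triples, every point is covered at most about \<open>4 k\<close> times, so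
  \<open>n * ln M \<le> (4 + o(1)) * k * W n\<close>, with \<open>M\<close> equal to \<open>k\<close> up to logarithmic factors.

  Upper bound. The word consists of permutations of the alphabet repeating with period four, each
  ordering the letters lexicographically by their bits with certain bits reversed. Common increasing
  runs of consecutive permutations have length at most \<open>K\<close>, those at distance two at most \<open>K\<^sup>2\<close>, where
  \<open>K\<close> is about \<open>k powr (1/4)\<close>, and three different ones share no pair of letters. A map cuts \<open>v\<close>
  into increasing runs. Looking at which later cut first passes the end of the run containing the
  next one, the next \<open>i\<close> cuts have \<open>O(K ^ i)\<close> choices for some \<open>i\<close> between 1 and 4; for \<open>i = 4\<close> this
  uses that a common run of length \<open>r\<close> spreads over \<open>\<Omega>(r\<^sup>2)\<close> ranks in each permutation.\<close>

section \<open>Counting maps\<close>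

text \<open>Recursion on \<open>w\<close> replaces sets of maps: either position 0 of
  \<open>w\<close> is skipped, or it receives the first letter of \<open>v\<close>.\<close>

fun cnt :: "'a list \<Rightarrow> 'a list \<Rightarrow> nat" where
  "cnt [] w = 1"
| "cnt (a # v) [] = 0"
| "cnt (a # v) (b # w) = cnt (a # v) w + (if a = b then cnt v w else 0)"

lemma word_maps_iff:
  "f \<in> word_maps v w \<longleftrightarrow> f \<in> extensional {..<length v} \<and> (\<forall>i<length v. f i < length w \<and> v ! i = w ! f i) \<and>
     (\<forall>i j. i < j \<longrightarrow> j < length v \<longrightarrow> f i < f j)"
  by (auto simp: word_maps_def PiE_def Pi_def strict_mono_on_def)

lemma finite_word_maps [simp]: "finite (word_maps v w)"
  unfolding word_maps_def by (rule finite_subset[OF _ finite_PiE[of "{..<length v}" "\<lambda>_. {..<length w}"]]) auto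

text \<open>A map into \<open>b # w\<close> either avoids position 0, and then comes from
  \<open>shift_map\<close>, or sends the first letter there, and then comes from
  \<open>cons_map\<close>. \<open>restrict\<close> keeps both images extensional.\<close>

definition shift_map :: "nat \<Rightarrow> (nat \<Rightarrow> nat) \<Rightarrow> nat \<Rightarrow> nat" where
  "shift_map m f = restrict (\<lambda>i. Suc (f i)) {..<m}"

definition cons_map :: "nat \<Rightarrow> (nat \<Rightarrow> nat) \<Rightarrow> nat \<Rightarrow> nat" where
  "cons_map m f = restrict (case_nat 0 (\<lambda>i. Suc (f i))) {..<Suc m}"

lemma inj_shift_map: "inj_on (shift_map (length v)) (word_maps v w)"
proof (rule inj_onI)
  fix f g assume f: "f \<in> word_maps v w" and g: "g \<in> word_maps v w" and e: "shift_map (length v) f = shift_map (length v) g"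
  have "f i = g i" if "i < length v" for i
    using fun_cong[OF e, of i] that by (simp add: shift_map_def)
  then show "f = g" using f g by (auto simp: word_maps_iff intro: extensionalityI)
qed

lemma inj_cons_map: "inj_on (cons_map (length v)) (word_maps v w)"
proof (rule inj_onI)
  fix f g assume f: "f \<in> word_maps v w" and g: "g \<in> word_maps v w" and e: "cons_map (length v) f = cons_map (length v) g"
  have "f i = g i" if "i < length v" for i
    using fun_cong[OF e, of "Suc i"] that by (simp add: cons_map_def)
  then show "f = g" using f g by (auto simp: word_maps_iff intro: extensionalityI)
qed

lemma word_maps_Cons:
  "word_maps (a # v) (b # w) = shift_map (Suc (length v)) ` word_maps (a # v) w \<union>
     (if a = b then cons_map (length v) ` word_maps v w else {})"
proof (intro equalityI subsetI)
  fix f assume f: "f \<in> word_maps (a # v) (b # w)"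
  show "f \<in> shift_map (Suc (length v)) ` word_maps (a # v) w \<union>
     (if a = b then cons_map (length v) ` word_maps v w else {})"
  proof (cases "f 0")
    case 0
    define g where "g = restrict (\<lambda>i. f (Suc i) - 1) {..<length v}"
    have pos: "0 < f (Suc i)" if "i < length v" for i
      using f that 0 unfolding word_maps_iff by (metis length_Cons not_less_eq zero_less_Suc)
    have fs: "f (Suc i) = Suc (g i)" if "i < length v" for i
      using pos[OF that] that by (simp add: g_def)
    have "a = b" using f 0 unfolding word_maps_iff by (metis length_Cons nth_Cons_0 zero_less_Suc)
    moreover have "g \<in> word_maps v w"
      unfolding word_maps_iff
    proof (intro conjI allI impI)
      show "g \<in> extensional {..<length v}" by (simp add: g_def)
      fix i assume i: "i < length v"
      have "f (Suc i) < length (b # w) \<and> (a # v) ! Suc i = (b # w) ! f (Suc i)"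
        using f i unfolding word_maps_iff by (metis Suc_less_eq length_Cons)
      then show "g i < length w" "v ! i = w ! g i" using fs[OF i] by auto
    next
      fix i j assume ij: "i < j" "j < length v"
      have "f (Suc i) < f (Suc j)" using f ij unfolding word_maps_iff by (metis Suc_less_eq length_Cons)
      then show "g i < g j" using fs ij by auto
    qed
    moreover have "f = cons_map (length v) g"
    proof (rule extensionalityI[of _ "{..<Suc (length v)}"])
      show "f \<in> extensional {..<Suc (length v)}" using f by (simp add: word_maps_iff)
      show "cons_map (length v) g \<in> extensional {..<Suc (length v)}" by (simp add: cons_map_def)
      fix i assume "i \<in> {..<Suc (length v)}"
      then show "f i = cons_map (length v) g i" using fs 0
        by (cases i) (auto simp: cons_map_def)
    qed
    ultimately show ?thesis by auto
  next
    case (Suc n0)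
    define g where "g = restrict (\<lambda>i. f i - 1) {..<Suc (length v)}"
    have pos: "0 < f i" if "i < Suc (length v)" for i
      using f that Suc unfolding word_maps_iff by (metis gr_zeroI length_Cons less_nat_zero_code nat.distinct(1) )
    have fs: "f i = Suc (g i)" if "i < Suc (length v)" for i
      using pos[OF that] that by (simp add: g_def)
    have "g \<in> word_maps (a # v) w"
      unfolding word_maps_iff
    proof (intro conjI allI impI)
      show "g \<in> extensional {..<length (a # v)}" by (simp add: g_def)
      fix i assume i: "i < length (a # v)"
      have "f i < length (b # w) \<and> (a # v) ! i = (b # w) ! f i"
        using f i unfolding word_maps_iff by blast
      then show "g i < length w" "(a # v) ! i = w ! g i" using fs[of i] i by auto
    next
      fix i j assume ij: "i < j" "j < length (a # v)"
      have "f i < f j" using f ij unfolding word_maps_iff by blast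
      then show "g i < g j" using fs[of i] fs[of j] ij by auto
    qed
    moreover have "f = shift_map (Suc (length v)) g"
    proof (rule extensionalityI[of _ "{..<Suc (length v)}"])
      show "f \<in> extensional {..<Suc (length v)}" using f by (simp add: word_maps_iff)
      show "shift_map (Suc (length v)) g \<in> extensional {..<Suc (length v)}" by (simp add: shift_map_def)
      fix i assume "i \<in> {..<Suc (length v)}"
      then show "f i = shift_map (Suc (length v)) g i" using fs
        by (auto simp: shift_map_def)
    qed
    ultimately show ?thesis by auto
  qed
next
  fix f assume "f \<in> shift_map (Suc (length v)) ` word_maps (a # v) w \<union>
     (if a = b then cons_map (length v) ` word_maps v w else {})"
  then consider g where "f = shift_map (Suc (length v)) g" "g \<in> word_maps (a # v) w"
    | g where "a = b" "f = cons_map (length v) g" "g \<in> word_maps v w"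
    by (auto split: if_splits)
  then show "f \<in> word_maps (a # v) (b # w)"
  proof cases
    case 1 then show ?thesis by (auto simp: word_maps_iff shift_map_def)
  next
    case 2
    then show ?thesis
      by (auto simp: word_maps_iff cons_map_def nth_Cons split: nat.splits)
  qed
qed

lemma num_maps_eq_cnt: "num_maps v w = cnt v w"
proof (induction v w rule: cnt.induct)
  case (1 w)
  have "word_maps [] w = {\<lambda>_. undefined}" by (auto simp: word_maps_def)
  then show ?case by (simp add: num_maps_def)
next
  case (2 a v)
  then show ?case by (simp add: num_maps_eq_0)
next
  case (3 a v b w)
  have disj: "shift_map (Suc (length v)) ` word_maps (a # v) w \<inter> cons_map (length v) ` word_maps v w = {}"
  proof -
    have "shift_map (Suc (length v)) f 0 \<noteq> cons_map (length v) g 0" for f g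
      by (simp add: shift_map_def cons_map_def)
    then show ?thesis by (metis (no_types, lifting) disjoint_iff imageE)
  qed
  have "num_maps (a # v) (b # w) = num_maps (a # v) w + (if a = b then num_maps v w else 0)"
  proof (cases "a = b")
    case True
    have "card (word_maps (a # v) (b # w)) =
        card (shift_map (Suc (length v)) ` word_maps (a # v) w) + card (cons_map (length v) ` word_maps v w)"
      unfolding word_maps_Cons if_P[OF True] by (intro card_Un_disjoint finite_imageI finite_word_maps disj)
    then show ?thesis
      using True inj_shift_map[of "a # v" w] inj_cons_map[of v w] by (simp add: num_maps_def card_image)
  next
    case False
    then show ?thesis
      using inj_shift_map[of "a # v" w] by (simp add: num_maps_def word_maps_Cons card_image)
  qed
  then show ?case using 3 by simp
qed

text \<open>Monotonicity forces the letters sent into \<open>w1\<close> to form a prefix of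
  \<open>v\<close>; \<open>j\<close> is its length.\<close>

lemma cnt_append:
  "cnt v (w1 @ w2) = (\<Sum>j\<le>length v. cnt (take j v) w1 * cnt (drop j v) w2)"
proof (induction w1 arbitrary: v)
  case Nil
  have "(\<Sum>j\<le>length v. cnt (take j v) ([]::'a list) * cnt (drop j v) w2) =
        (\<Sum>j\<in>{0}. cnt (take j v) ([]::'a list) * cnt (drop j v) w2)"
  proof (rule sum.mono_neutral_right)
    show "\<forall>i\<in>{..length v} - {0}. cnt (take i v) ([]::'a list) * cnt (drop i v) w2 = 0"
      by (cases v) (auto simp: take_Cons split: nat.splits)
  qed auto
  then show ?case by simp
next
  case (Cons b w1)
  show ?case
  proof (cases v)
    case Nil then show ?thesis by simp
  next
    case v: (Cons a u)
    have "(\<Sum>j\<le>length v. cnt (take j v) (b # w1) * cnt (drop j v) w2)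
       = cnt v w2 + (\<Sum>j\<le>length u. (cnt (a # take j u) w1 + (if a = b then cnt (take j u) w1 else 0)) * cnt (drop j u) w2)"
      unfolding v length_Cons sum.atMost_Suc_shift by simp
    also have "\<dots> = (cnt v w2 + (\<Sum>j\<le>length u. cnt (a # take j u) w1 * cnt (drop j u) w2))
        + (if a = b then (\<Sum>j\<le>length u. cnt (take j u) w1 * cnt (drop j u) w2) else 0)"
      by (simp add: sum.distrib algebra_simps)
    also have "cnt v w2 + (\<Sum>j\<le>length u. cnt (a # take j u) w1 * cnt (drop j u) w2) = cnt v (w1 @ w2)"
      unfolding Cons.IH unfolding v length_Cons sum.atMost_Suc_shift by simp
    also have "(\<Sum>j\<le>length u. cnt (take j u) w1 * cnt (drop j u) w2) = cnt u (w1 @ w2)"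
      unfolding Cons.IH ..
    finally show ?thesis by (simp add: v)
  qed
qed

lemma cnt_append_ge: "cnt v1 w1 * cnt v2 w2 \<le> cnt (v1 @ v2) (w1 @ w2)"
proof -
  have "cnt (take (length v1) (v1 @ v2)) w1 * cnt (drop (length v1) (v1 @ v2)) w2 \<le> cnt (v1 @ v2) (w1 @ w2)"
    unfolding cnt_append by (rule member_le_sum) auto
  then show ?thesis by simp
qed

section \<open>The largest count and its supermultiplicativity under concatenation\<close>

lemma max_maps_ge: "v \<in> words k \<Longrightarrow> cnt v w \<le> max_maps k w"
  unfolding max_maps_def num_maps_eq_cnt[symmetric] by (rule Max_ge) (auto intro: finite_num_maps_image)

lemma max_maps_attained: obtains v where "v \<in> words k" "cnt v w = max_maps k w"
proof -
  have "max_maps k w \<in> (\<lambda>v. num_maps v w) ` words k"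
    unfolding max_maps_def by (rule Max_in) (auto intro: finite_num_maps_image simp: words_nonempty)
  then show thesis using that by (auto simp: num_maps_eq_cnt)
qed

lemma max_maps_append: "max_maps k w1 * max_maps k w2 \<le> max_maps k (w1 @ w2)"
proof -
  obtain v1 where 1: "v1 \<in> words k" "cnt v1 w1 = max_maps k w1" by (rule max_maps_attained)
  obtain v2 where 2: "v2 \<in> words k" "cnt v2 w2 = max_maps k w2" by (rule max_maps_attained)
  have "v1 @ v2 \<in> words k" using 1 2 by (simp add: words_def)
  then show ?thesis using cnt_append_ge[of v1 w1 v2 w2] max_maps_ge[of "v1 @ v2" k "w1 @ w2"] 1 2 by simp
qed

lemma max_maps_pos: "1 \<le> max_maps k w"
  using max_maps_ge[of "[]" k w] by (simp add: words_def)

section \<open>Twins and three orders\<close>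

text \<open>For injective \<open>f\<close> and \<open>g\<close> the two orders coincide on
  \<open>X\<close>, so that \<open>X\<close> is a common increasing subsequence of both.\<close>

definition agree_on :: "'a set \<Rightarrow> ('a \<Rightarrow> nat) \<Rightarrow> ('a \<Rightarrow> nat) \<Rightarrow> bool" where
  "agree_on X f g \<longleftrightarrow> (\<forall>x\<in>X. \<forall>y\<in>X. f x < f y \<longleftrightarrow> g x < g y)"

text \<open>An Erdos-Szekeres label: the size of the largest common chain ending at
  \<open>x\<close>. Ending is expressed through \<open>f\<close> alone; agreement carries it over to
  \<open>g\<close>.\<close>

definition chain_rank :: "'a set \<Rightarrow> ('a \<Rightarrow> nat) \<Rightarrow> ('a \<Rightarrow> nat) \<Rightarrow> 'a \<Rightarrow> nat" where
  "chain_rank X f g x = Max (card ` {Y. Y \<subseteq> X \<and> x \<in> Y \<and> agree_on Y f g \<and> (\<forall>y\<in>Y. f y \<le> f x)})"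

lemma chain_rank_attained:
  assumes "finite X" "x \<in> X"
  obtains Y where "Y \<subseteq> X" "x \<in> Y" "agree_on Y f g" "\<forall>y\<in>Y. f y \<le> f x" "card Y = chain_rank X f g x"
proof -
  let ?F = "{Y. Y \<subseteq> X \<and> x \<in> Y \<and> agree_on Y f g \<and> (\<forall>y\<in>Y. f y \<le> f x)}"
  have "{x} \<in> ?F" using assms by (auto simp: agree_on_def)
  moreover have "finite ?F" using assms by (auto intro: finite_subset[of _ "Pow X"])
  ultimately have "chain_rank X f g x \<in> card ` ?F"
    unfolding chain_rank_def by (intro Max_in) auto
  then show thesis using that by auto
qed

lemma chain_rank_ge:
  assumes "finite X" "Y \<subseteq> X" "x \<in> Y" "agree_on Y f g" "\<forall>y\<in>Y. f y \<le> f x"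
  shows "card Y \<le> chain_rank X f g x"
proof -
  have "finite {Y. Y \<subseteq> X \<and> x \<in> Y \<and> agree_on Y f g \<and> (\<forall>y\<in>Y. f y \<le> f x)}"
    using assms by (auto intro: finite_subset[of _ "Pow X"])
  then show ?thesis unfolding chain_rank_def using assms by (intro Max_ge) auto
qed

lemma chain_rank_less:
  assumes X: "finite X" "x \<in> X" "y \<in> X" and inj: "inj_on f X" "inj_on g X" and less: "f x < f y" "g x < g y"
  shows "chain_rank X f g x < chain_rank X f g y"
proof -
  obtain Y where Y: "Y \<subseteq> X" "x \<in> Y" "agree_on Y f g" "\<forall>y\<in>Y. f y \<le> f x" "card Y = chain_rank X f g x"
    using chain_rank_attained X by metis
  have gle: "g z \<le> g x" if "z \<in> Y" for z
  proof (rule ccontr)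
    assume "\<not> g z \<le> g x"
    then have "f x < f z" using Y that by (auto simp: agree_on_def)
    then show False using Y that by auto
  qed
  have "y \<notin> Y" using Y less by auto
  have "agree_on (insert y Y) f g"
    using Y(3) gle Y(4) less unfolding agree_on_def by (auto; meson order.strict_trans1 order.asym leD le_less_trans less_asym)
  then have "card (insert y Y) \<le> chain_rank X f g y"
    using X Y less by (intro chain_rank_ge) auto
  moreover have "finite Y" using Y X finite_subset by blast
  ultimately show ?thesis using \<open>y \<notin> Y\<close> Y by simp
qed

text \<open>Of three linear orders, two agree on any given pair of points; hence the three chain ranks
  separate points.\<close>
lemma three_orders:
  assumes X: "finite X" "X \<noteq> {}" and inj: "inj_on f X" "inj_on g X" "inj_on h X"
  obtains A B C where "A \<subseteq> X" "agree_on A f g" "B \<subseteq> X" "agree_on B g h" "C \<subseteq> X" "agree_on C f h"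
    "card X \<le> card A * card B * card C" "A \<noteq> {}" "B \<noteq> {}" "C \<noteq> {}"
proof -
  \<comment> \<open>The largest label is the size of an actual chain \<open>A\<close>, and
    singletons make every label at least 1, so labels take at most \<open>card A\<close>
    values.\<close>
  have best: "\<exists>A. A \<subseteq> X \<and> A \<noteq> {} \<and> agree_on A p q \<and> (\<forall>x\<in>X. chain_rank X p q x \<in> {1..card A})" for p q
  proof -
    define r where "r = Max (chain_rank X p q ` X)"
    have "r \<in> chain_rank X p q ` X" unfolding r_def using X by (intro Max_in) auto
    then obtain x where x: "x \<in> X" "chain_rank X p q x = r" by auto
    obtain A where A: "A \<subseteq> X" "x \<in> A" "agree_on A p q" "card A = chain_rank X p q x"
      using chain_rank_attained[OF X(1) x(1)] by metis
    have "chain_rank X p q y \<in> {1..card A}" if y: "y \<in> X" for y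
    proof -
      have "card {y} \<le> chain_rank X p q y" using X y by (intro chain_rank_ge) (auto simp: agree_on_def)
      moreover have "chain_rank X p q y \<le> r" unfolding r_def using X y by (intro Max_ge) auto
      ultimately show ?thesis using A x by auto
    qed
    then show ?thesis using A by blast
  qed
  obtain A where A: "A \<subseteq> X" "A \<noteq> {}" "agree_on A f g" "\<forall>x\<in>X. chain_rank X f g x \<in> {1..card A}" using best by metis
  obtain B where B: "B \<subseteq> X" "B \<noteq> {}" "agree_on B g h" "\<forall>x\<in>X. chain_rank X g h x \<in> {1..card B}" using best by metis
  obtain C where C: "C \<subseteq> X" "C \<noteq> {}" "agree_on C f h" "\<forall>x\<in>X. chain_rank X f h x \<in> {1..card C}" using best by metis
  define l where "l x = (chain_rank X f g x, chain_rank X g h x, chain_rank X f h x)" for x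
  have "inj_on l X"
  proof (rule inj_onI, rule ccontr)
    fix x y assume xy: "x \<in> X" "y \<in> X" "l x = l y" "x \<noteq> y"
    have ne: "f x \<noteq> f y" "g x \<noteq> g y" "h x \<noteq> h y" using xy inj by (auto dest: inj_onD)
    have *: "\<not> (p u < p v \<and> q u < q v)"
      if "(u, v) \<in> {(x, y), (y, x)}" "(p, q) \<in> {(f, g), (g, h), (f, h)}" for p q u v
      using chain_rank_less[OF X(1), of u v p q] that xy inj by (auto simp: l_def)
    have "\<not> (f x < f y \<and> g x < g y)" "\<not> (f y < f x \<and> g y < g x)"
      "\<not> (g x < g y \<and> h x < h y)" "\<not> (g y < g x \<and> h y < h x)"
      "\<not> (f x < f y \<and> h x < h y)" "\<not> (f y < f x \<and> h y < h x)"
      using *[of x y f g] *[of y x f g] *[of x y g h] *[of y x g h] *[of x y f h] *[of y x f h] by simp_all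
    then show False using ne by linarith
  qed
  moreover have "l ` X \<subseteq> {1..card A} \<times> {1..card B} \<times> {1..card C}"
    using A B C by (auto simp: l_def)
  ultimately have "card X \<le> card ({1..card A} \<times> {1..card B} \<times> {1..card C})"
    by (intro card_inj_on_le) auto
  then have "card X \<le> card A * card B * card C" by (simp add: card_cartesian_product mult.assoc)
  then show thesis using that A B C by blast
qed

lemma set_subset_words: "set v \<subseteq> {1..k} \<longleftrightarrow> v \<in> words k"
  by (auto simp: words_def)

text \<open>The common subsequence embeds in \<open>card Y\<close> ways: a prefix into its first copy and the rest into
  the second.\<close>
lemma twins_max_maps:
  assumes Y: "finite Y" and h: "strict_mono_on Y h" and w: "set w \<subseteq> {1..k}"
    and Yh: "\<And>x. x \<in> Y \<Longrightarrow> s \<le> x \<and> x < h x \<and> h x < e \<and> h x < length w \<and> w ! h x = w ! x"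
  shows "card Y * max_maps k (take s w) \<le> max_maps k (take e w)"
proof (cases "Y = {}")
  case False
  define a where "a = card Y"
  define P where "P = (\<lambda>i. sorted_list_of_set Y ! i)"
  define u where "u = map (\<lambda>i. w ! P i) [0..<a]"
  define z where "z = drop s (take e w)"
  have PY: "P i \<in> Y" if "i < a" for i
    using that Y by (metis P_def a_def nth_mem set_sorted_list_of_set length_sorted_list_of_set)
  have Pmono: "P i < P j" if "i < j" "j < a" for i j
    using that Y strict_sorted_list_of_set[of Y] unfolding P_def a_def
    by (simp add: sorted_wrt_iff_nth_less)
  have Plemono: "P i \<le> P j" if "i \<le> j" "j < a" for i j
    using Pmono[of i j] that by (cases "i = j") auto
  have Qmono: "h (P i) < h (P j)" if "i < j" "j < a" for i j
    using that PY Pmono h by (auto simp: strict_mono_on_def)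
  obtain x where "x \<in> Y" using False by blast
  then have "s \<le> e" using Yh by force
  then have tk: "take e w = take s w @ z"
    unfolding z_def by (metis append_take_drop_id min.absorb1 take_take)
  have lz: "length z = min e (length w) - s" unfolding z_def by auto
  have zn: "z ! (x - s) = w ! x" if "s \<le> x" "x < e" "x < length w" for x
    using that unfolding z_def by simp
  \<comment> \<open>The shift by \<open>s\<close> is there because \<open>z\<close> starts at
    position \<open>s\<close> of \<open>w\<close>. For \<open>i < j\<close> the maps
    \<open>F i\<close> and \<open>F j\<close> differ at letter \<open>i\<close>, which only
    \<open>F j\<close> sends to its first copy.\<close>
  define F where "F i = restrict (\<lambda>j. (if j < i then P j else h (P j)) - s) {..<a}" for i
  have F: "F i \<in> word_maps u z" if "i < a" for i
    unfolding word_maps_iff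
  proof (intro conjI allI impI)
    show "F i \<in> extensional {..<length u}" by (simp add: F_def u_def)
    fix j assume "j < length u"
    then have j: "j < a" by (simp add: u_def)
    note b = Yh[OF PY[OF j]]
    show "F i j < length z" using b j by (auto simp: F_def lz)
    show "u ! j = z ! F i j" using b j zn[of "P j"] zn[of "h (P j)"] by (auto simp: F_def u_def)
  next
    fix j l assume jl: "j < l" "l < length u"
    then have l: "l < a" by (simp add: u_def)
    have "P j < P l" "h (P j) < h (P l)" using Pmono Qmono jl l by auto
    then show "F i j < F i l" using Yh[OF PY[OF l]] Yh[OF PY[of j]] jl l
      by (auto simp: F_def)
  qed
  have "inj_on F {..<a}"
  proof (rule inj_onI, rule ccontr)
    have *: False if "i < j" "j < a" "F i = F j" for i j
      using fun_cong[OF that(3), of i] that Yh[OF PY[of i]] by (auto simp: F_def)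
    fix i j assume "i \<in> {..<a}" "j \<in> {..<a}" "F i = F j" "i \<noteq> j"
    then show False using *[of i j] *[of j i] by (cases "i < j") auto
  qed
  then have "card {..<a} \<le> card (word_maps u z)"
    by (rule card_inj_on_le) (use F in auto)
  then have cu: "a \<le> cnt u z" by (simp add: num_maps_eq_cnt[symmetric] num_maps_def)
  have "w ! P j \<in> {1..k}" if "j < a" for j
    using Yh[OF PY[OF that]] w by (metis less_trans nth_mem subsetD)
  then have "u \<in> words k" by (auto simp: u_def set_subset_words[symmetric])
  then have "a \<le> max_maps k z" using max_maps_ge cu by (meson order_trans)
  then have "a * max_maps k (take s w) \<le> max_maps k z * max_maps k (take s w)" by simp
  also have "\<dots> \<le> max_maps k (take e w)"
    unfolding tk using max_maps_append[of k "take s w" z] by (simp add: mult.commute)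
  finally show ?thesis by (simp add: a_def)
qed simp

lemma max_maps_take_mono: "i \<le> j \<Longrightarrow> max_maps k (take i w) \<le> max_maps k (take j w)"
proof -
  assume "i \<le> j"
  then have "take j w = take i w @ drop i (take j w)" by (metis append_take_drop_id min.absorb1 take_take)
  then show ?thesis using max_maps_append[of k "take i w" "drop i (take j w)"] max_maps_pos[of k "drop i (take j w)"]
    by (metis mult.right_neutral mult_le_mono2 order_trans)
qed

section \<open>Triples of consecutive occurrences\<close>

definition has_next :: "'a list \<Rightarrow> nat \<Rightarrow> bool" where
  "has_next w p \<longleftrightarrow> (\<exists>q>p. q < length w \<and> w ! q = w ! p)"

definition next_occ :: "'a list \<Rightarrow> nat \<Rightarrow> nat" where
  "next_occ w p = (LEAST q. p < q \<and> q < length w \<and> w ! q = w ! p)"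

lemma next_occ:
  assumes "has_next w p"
  shows "p < next_occ w p" "next_occ w p < length w" "w ! next_occ w p = w ! p"
  using LeastI_ex[of "\<lambda>q. p < q \<and> q < length w \<and> w ! q = w ! p"] assms
  by (auto simp: has_next_def next_occ_def)

lemma next_occ_le: "p < q \<Longrightarrow> q < length w \<Longrightarrow> w ! q = w ! p \<Longrightarrow> next_occ w p \<le> q"
  unfolding next_occ_def by (intro Least_le) auto

text \<open>If \<open>p < q\<close> had the same next occurrence, both would carry its letter, and
  \<open>q\<close> itself would be an earlier occurrence after \<open>p\<close>.\<close>

lemma inj_next_occ: "inj_on (next_occ w) {p. has_next w p}"
proof (rule inj_onI, rule ccontr)
  have *: False if "has_next w p" "has_next w q" "next_occ w p = next_occ w q" "p < q" for p q
  proof -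
    have "q < length w" using next_occ[OF that(2)] by linarith
    then have "next_occ w p \<le> q" using next_occ(3)[OF that(1)] next_occ(3)[OF that(2)] that by (intro next_occ_le) auto
    then show False using next_occ(1)[OF that(2)] that by simp
  qed
  fix p q assume "p \<in> {p. has_next w p}" "q \<in> {p. has_next w p}" "next_occ w p = next_occ w q" "p \<noteq> q"
  then show False using *[of p q] *[of q p] by (cases "p < q") auto
qed

definition triples :: "'a list \<Rightarrow> nat set" where
  "triples w = {p. has_next w p \<and> has_next w (next_occ w p)}"

definition next2 :: "'a list \<Rightarrow> nat \<Rightarrow> nat" where
  "next2 w p = next_occ w (next_occ w p)"

lemma triples:
  assumes "p \<in> triples w"
  shows "p < next_occ w p" "next_occ w p < next2 w p" "next2 w p < length w"
    "w ! next_occ w p = w ! p" "w ! next2 w p = w ! p"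
  using assms next_occ[of w p] next_occ[of w "next_occ w p"] by (auto simp: triples_def next2_def)

lemma triples_lessThan: "triples w \<subseteq> {..<length w}"
  using triples by fastforce

lemma finite_triples [simp]: "finite (triples w)"
  using triples_lessThan finite_subset by blast

lemma inj_triples: "inj_on (next_occ w) (triples w)" "inj_on (next2 w) (triples w)"
  using inj_next_occ[of w] by (auto simp: inj_on_def triples_def next2_def)

text \<open>A position that starts no triple is the last or the last but one occurrence of its
  letter: \<open>E\<close> injects into the alphabet, and \<open>F\<close> into \<open>E\<close>
  through \<open>next_occ\<close>.\<close>

lemma card_no_triple:
  assumes w: "set w \<subseteq> {1..k}"
  shows "card ({..<length w} - triples w) \<le> 2 * k"
proof -
  define E where "E = {p. p < length w \<and> \<not> has_next w p}"
  have E: "card E \<le> k"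
  proof -
    have "inj_on (\<lambda>p. w ! p) E"
    proof (rule inj_onI, rule ccontr)
      fix p q assume "p \<in> E" "q \<in> E" "w ! p = w ! q" "p \<noteq> q"
      then show False unfolding E_def has_next_def
        by (metis (mono_tags, lifting) linorder_neqE_nat mem_Collect_eq)
    qed
    moreover have "(\<lambda>p. w ! p) ` E \<subseteq> {1..k}" using w by (force simp: E_def dest: nth_mem)
    ultimately have "card E \<le> card {1..k}" by (intro card_inj_on_le) auto
    then show ?thesis by simp
  qed
  have fE: "finite E" by (simp add: E_def)
  define F where "F = {p. has_next w p \<and> \<not> has_next w (next_occ w p)}"
  have "card F \<le> card E"
    using next_occ(2) inj_next_occ[of w] fE
    by (intro card_inj_on_le[of "next_occ w"]) (auto simp: F_def E_def inj_on_def)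
  moreover have "{..<length w} - triples w \<subseteq> E \<union> F" by (auto simp: E_def F_def triples_def)
  moreover have "finite F" by (rule finite_subset[of _ "{..<length w}"]) (auto simp: F_def has_next_def)
  ultimately have "card ({..<length w} - triples w) \<le> card E + card F"
    by (meson card_mono card_Un_le fE finite_UnI order_trans)
  then show ?thesis using E \<open>card F \<le> card E\<close> by linarith
qed

text \<open>Since \<open>next2\<close> is injective, all but \<open>2 k\<close> of the terms cancel.\<close>
lemma sum_next2_diff:
  fixes g :: "nat \<Rightarrow> real"
  assumes w: "set w \<subseteq> {1..k}" and g: "\<And>q. q < length w \<Longrightarrow> 0 \<le> g q \<and> g q \<le> G" and G: "0 \<le> G"
  shows "(\<Sum>p\<in>triples w. g (next2 w p) - g p) \<le> 2 * real k * G"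
proof -
  let ?T = "triples w" and ?N = "{..<length w}"
  have "(\<Sum>p\<in>?T. g (next2 w p)) = (\<Sum>q\<in>next2 w ` ?T. g q)"
    by (simp add: sum.reindex inj_triples)
  also have "\<dots> \<le> (\<Sum>q\<in>?N. g q)"
    using g triples(3)[of _ w] by (intro sum_mono2) auto
  also have "\<dots> = (\<Sum>q\<in>?T. g q) + (\<Sum>q\<in>?N - ?T. g q)"
    by (simp add: sum.subset_diff[OF triples_lessThan])
  also have "(\<Sum>q\<in>?N - ?T. g q) \<le> (\<Sum>q\<in>?N - ?T. G)"
    using g by (intro sum_mono) auto
  also have "\<dots> = real (card (?N - ?T)) * G" by simp
  also have "\<dots> \<le> 2 * real k * G"
    using card_no_triple[OF w] G by (intro mult_right_mono) linarith+
  finally show ?thesis by (simp add: sum_subtractf)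
qed

text \<open>By injectivity of \<open>h\<close> each position is hit at most once, so the increment
  over each cell is counted at most \<open>s\<close> times, and the increments telescope.\<close>

lemma sum_cells:
  fixes V :: "nat \<Rightarrow> real"
  assumes V: "\<And>i. 0 \<le> V i \<and> V i \<le> V (Suc i) \<and> V i \<le> G" and h: "inj_on h A" "h ` A \<subseteq> {..<n}" "finite A" and s: "s > 0"
  shows "(\<Sum>p\<in>A. V (Suc (h p div s)) - V (h p div s)) \<le> real s * G"
proof -
  let ?d = "\<lambda>q. V (Suc (q div s)) - V (q div s)"
  define r where "r = Suc (n div s)"
  have "n \<le> r * s" unfolding r_def using dividend_less_div_times[of s n] s by simp
  have "(\<Sum>p\<in>A. ?d (h p)) = (\<Sum>q\<in>h ` A. ?d q)" by (simp add: sum.reindex h)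
  also have "\<dots> \<le> (\<Sum>q<r * s. ?d q)" using h V \<open>n \<le> r * s\<close> by (intro sum_mono2) auto
  also have "\<dots> = (\<Sum>m<r. sum ?d {m * s..<m * s + s})" by (simp add: sum.nat_group)
  also have "\<dots> = (\<Sum>m<r. real s * (V (Suc m) - V m))"
  proof (rule sum.cong[OF refl])
    fix m
    have "sum ?d {m * s..<m * s + s} = (\<Sum>q\<in>{m * s..<m * s + s}. V (Suc m) - V m)"
    proof (rule sum.cong[OF refl])
      fix q assume "q \<in> {m * s..<m * s + s}"
      then have "q div s = m" by (intro div_nat_eqI) (auto simp: algebra_simps)
      then show "?d q = V (Suc m) - V m" by simp
    qed
    then show "sum ?d {m * s..<m * s + s} = real s * (V (Suc m) - V m)" by simp
  qed
  also have "\<dots> = real s * (V r - V 0)" by (simp add: sum_distrib_left[symmetric] sum_lessThan_telescope)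
  also have "\<dots> \<le> real s * G" using V[of r] V[of 0] by (intro mult_left_mono) auto
  finally show ?thesis .
qed

section \<open>Growth of the logarithm over cells\<close>

definition cell :: "nat \<Rightarrow> 'a list \<Rightarrow> nat \<Rightarrow> nat \<times> nat \<times> nat" where
  "cell s w p = (p div s, next_occ w p div s, next2 w p div s)"

definition log_max :: "nat \<Rightarrow> nat list \<Rightarrow> nat \<Rightarrow> real" where
  "log_max k w i = ln (real (max_maps k (take i w)))"

lemma log_max_nonneg: "0 \<le> log_max k w i"
  using max_maps_pos[of k "take i w"] by (simp add: log_max_def)

lemma log_max_mono: "i \<le> j \<Longrightarrow> log_max k w i \<le> log_max k w j"
  using max_maps_take_mono[of i j k w] max_maps_pos[of k "take i w"] by (simp add: log_max_def)

lemma log_max_twins: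
  assumes Y: "finite Y" "Y \<noteq> {}" and h: "strict_mono_on Y h" and w: "set w \<subseteq> {1..k}"
    and Yh: "\<And>x. x \<in> Y \<Longrightarrow> s \<le> x \<and> x < h x \<and> h x < e \<and> h x < length w \<and> w ! h x = w ! x"
  shows "ln (real (card Y)) + log_max k w s \<le> log_max k w e"
proof -
  have c: "card Y \<ge> 1" using Y by (simp add: Suc_leI card_gt_0_iff)
  have p: "max_maps k (take s w) \<ge> 1" by (rule max_maps_pos)
  have "ln (real (card Y)) + log_max k w s = ln (real (card Y * max_maps k (take s w)))"
    using c p by (simp add: log_max_def ln_mult)
  also have "\<dots> \<le> log_max k w e"
    unfolding log_max_def using twins_max_maps[OF Y(1) h w Yh] c p
    by (intro ln_mono) (auto simp del: of_nat_mult simp: of_nat_le_iff)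
  finally show ?thesis .
qed

text \<open>The elements of \<open>Y\<close> are labels, whereas twins are sets of positions:
  \<open>g \<circ> inv_into Y f\<close> carries the first copy to the second, and agreement makes it
  strictly increasing.\<close>

lemma log_max_agree:
  assumes Y: "finite Y" "Y \<noteq> {}" and w: "set w \<subseteq> {1..k}" and inj: "inj_on f Y" and ag: "agree_on Y f g"
    and Yh: "\<And>x. x \<in> Y \<Longrightarrow> s \<le> f x \<and> f x < g x \<and> g x < e \<and> g x < length w \<and> w ! g x = w ! f x"
  shows "ln (real (card Y)) + log_max k w s \<le> log_max k w e"
proof -
  have iv: "inv_into Y f (f x) = x" if "x \<in> Y" for x using inj that by simp
  have "strict_mono_on (f ` Y) (g \<circ> inv_into Y f)"
    using ag iv by (auto simp: strict_mono_on_def agree_on_def)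
  then have "ln (real (card (f ` Y))) + log_max k w s \<le> log_max k w e"
    using Y w Yh iv by (intro log_max_twins[where h = "g \<circ> inv_into Y f"]) auto
  then show ?thesis by (simp add: card_image inj)
qed

text \<open>Each of the three common subsequences from \<open>three_orders\<close> gives twins
  between two of the three cells. Their sizes multiply to at least \<open>card X\<close>, so the
  three gains in \<open>log_max\<close> add up to at least its logarithm.\<close>

lemma cell_gain:
  assumes w: "set w \<subseteq> {1..k}" and s: "s > 0" and X: "X \<subseteq> triples w" "X \<noteq> {}"
    and c: "\<And>p. p \<in> X \<Longrightarrow> cell s w p = (\<alpha>, \<beta>, \<gamma>)"
  shows "ln (real (card X)) \<le> 2 * (log_max k w (Suc \<gamma> * s) - log_max k w (\<alpha> * s))
      + (log_max k w (Suc \<beta> * s) - log_max k w (\<beta> * s))"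
proof -
  have fin: "finite X" using X finite_subset finite_triples by blast
  have injs: "inj_on (\<lambda>p. p) X" "inj_on (next_occ w) X" "inj_on (next2 w) X"
    using inj_triples[of w] X by (auto intro: inj_on_subset)
  obtain A B C where ABC: "A \<subseteq> X" "agree_on A (\<lambda>p. p) (next_occ w)" "B \<subseteq> X" "agree_on B (next_occ w) (next2 w)"
      "C \<subseteq> X" "agree_on C (\<lambda>p. p) (next2 w)" "card X \<le> card A * card B * card C" "A \<noteq> {}" "B \<noteq> {}" "C \<noteq> {}"
    using three_orders[OF fin X(2) injs] by metis
  have fins: "finite A" "finite B" "finite C" using ABC fin finite_subset by blast+
  have dv: "x div s = y \<Longrightarrow> y * s \<le> x \<and> x < Suc y * s" for x y
    using s dividend_less_div_times[of s x] by auto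
  have b: "\<alpha> * s \<le> p \<and> p < Suc \<alpha> * s \<and> \<beta> * s \<le> next_occ w p \<and> next_occ w p < Suc \<beta> * s \<and>
      \<gamma> * s \<le> next2 w p \<and> next2 w p < Suc \<gamma> * s" if "p \<in> X" for p
    using c[OF that] dv unfolding cell_def by blast
  have tr: "p < next_occ w p \<and> next_occ w p < next2 w p \<and> next_occ w p < length w \<and> next2 w p < length w \<and>
     w ! next_occ w p = w ! p \<and> w ! next2 w p = w ! p" if "p \<in> X" for p
    using triples[of p w] X that by auto
  have 1: "ln (real (card A)) + log_max k w (\<alpha> * s) \<le> log_max k w (Suc \<beta> * s)"
    by (rule log_max_agree[OF fins(1) ABC(8) w _ ABC(2)]) (use b tr ABC in \<open>auto simp del: mult_Suc\<close>)
  have 2: "ln (real (card B)) + log_max k w (\<beta> * s) \<le> log_max k w (Suc \<gamma> * s)"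
    by (rule log_max_agree[OF fins(2) ABC(9) w _ ABC(4)])
      (use b tr ABC injs in \<open>auto simp del: mult_Suc intro: inj_on_subset\<close>)
  have 3: "ln (real (card C)) + log_max k w (\<alpha> * s) \<le> log_max k w (Suc \<gamma> * s)"
  proof (rule log_max_agree[OF fins(3) ABC(10) w _ ABC(6)])
    fix x assume "x \<in> C"
    then have "x \<in> X" using ABC by auto
    then show "\<alpha> * s \<le> x \<and> x < next2 w x \<and> next2 w x < Suc \<gamma> * s \<and> next2 w x < length w \<and> w ! next2 w x = w ! x"
      using b[of x] tr[of x] by auto
  qed auto
  have cs: "card A \<ge> 1" "card B \<ge> 1" "card C \<ge> 1" "card X \<ge> 1"
    using fins fin ABC X by (simp_all add: Suc_leI card_gt_0_iff)
  have "ln (real (card X)) \<le> ln (real (card A * card B * card C))"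
    using ABC(7) cs by (intro ln_mono) (auto simp del: of_nat_mult simp: of_nat_le_iff)
  also have "\<dots> = ln (real (card A)) + ln (real (card B)) + ln (real (card C))"
    using cs by (simp add: ln_mult)
  finally have 4: "ln (real (card X)) \<le> ln (real (card A)) + ln (real (card B)) + ln (real (card C))" .
  \<comment> \<open>The intervals of \<open>A\<close> and \<open>B\<close> together cover that of
    \<open>C\<close> and overlap only in the middle cell, whence the additional last term.\<close>
  have "x \<le> 2 * (vg - va) + (vb' - vb)" if "x \<le> a + b + c" "a + va \<le> vb'" "b + vb \<le> vg" "c + va \<le> vg"
    for x a b c va vb vb' vg :: real using that by argo
  from this[OF 4 1 2 3] show ?thesis .
qed

text \<open>\<open>cell_gain\<close> is summed over the triples in large groups. The increments over
  single cells, five with multiplicity, cost \<open>s\<close> times the total each; what is left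
  over telescopes along \<open>next2\<close> at a cost of \<open>4 * k\<close>.\<close>

lemma log_max_lower:
  fixes M0 :: real
  assumes w: "set w \<subseteq> {1..k}" and s: "s > 0" and G: "Gd \<subseteq> triples w" and M0: "M0 > 0"
    and big: "\<And>p. p \<in> Gd \<Longrightarrow> M0 \<le> real (card {q \<in> triples w. cell s w q = cell s w p})"
  shows "real (card Gd) * ln M0 \<le> (4 * real k + 5 * real s) * log_max k w (length w)"
proof (cases "M0 \<ge> 1")
  case False
  then have "real (card Gd) * ln M0 \<le> 0" using M0 by (simp add: mult_nonneg_nonpos)
  also have "0 \<le> (4 * real k + 5 * real s) * log_max k w (length w)"
    using log_max_nonneg[of k w] by simp
  finally show ?thesis .
next
  case True
  let ?T = "triples w" and ?W = "log_max k w (length w)"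
  define V where "V i = log_max k w (i * s)" for i
  have Vm: "V i \<le> V j" if "i \<le> j" for i j unfolding V_def using that by (intro log_max_mono) simp
  \<comment> \<open>Cells may extend beyond the end of \<open>w\<close>, where \<open>take\<close>
    no longer changes and \<open>log_max\<close> is constant.\<close>
  have WG: "log_max k w i \<le> ?W" for i
    using log_max_mono[of i "max i (length w)" k w] by (auto simp: log_max_def max_def split: if_splits)
  have V: "0 \<le> V i \<and> V i \<le> V (Suc i) \<and> V i \<le> ?W" for i
    using Vm[of i "Suc i"] WG by (simp add: V_def log_max_nonneg)
  define \<Delta> where "\<Delta> i = V (Suc i) - V i" for i
  \<comment> \<open>Replacing the outer cell ends in \<open>cell_gain\<close> by the positions
    \<open>p\<close> and \<open>next2 w p\<close> costs one cell increment at either end. All terms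
    are nonnegative, so the sum may be extended to all triples.\<close>
  define R where "R p = 2 * \<Delta> (next2 w p div s) + 2 * \<Delta> (p div s) + \<Delta> (next_occ w p div s)
      + 2 * (log_max k w (next2 w p) - log_max k w p)" for p
  have D0: "0 \<le> \<Delta> i" for i using V by (simp add: \<Delta>_def)
  have R0: "0 \<le> R p" if "p \<in> ?T" for p
    using D0 log_max_mono[of p "next2 w p" k w] triples[OF that] unfolding R_def by (simp add: add_nonneg_nonneg)
  have gain: "ln M0 \<le> R p" if p: "p \<in> Gd" for p
  proof -
    let ?X = "{q \<in> ?T. cell s w q = cell s w p}"
    have "p \<in> ?X" using p G by auto
    then have "ln (real (card ?X)) \<le> 2 * (V (Suc (next2 w p div s)) - V (p div s)) + \<Delta> (next_occ w p div s)"
      unfolding V_def \<Delta>_def using w s by (intro cell_gain) (auto simp: cell_def)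
    moreover have "ln M0 \<le> ln (real (card ?X))" using big[OF p] M0 by (intro ln_mono) auto
    moreover have "V (next2 w p div s) \<le> log_max k w (next2 w p)"
      unfolding V_def by (intro log_max_mono) simp
    moreover have "log_max k w p \<le> V (Suc (p div s))"
      unfolding V_def by (rule log_max_mono) (use dividend_less_div_times[of s p] s in \<open>simp add: less_imp_le\<close>)
    moreover have "x \<le> 2 * (vg' - vg) + 2 * (va' - va) + d + 2 * (w2 - w1)"
      if "x' \<le> 2 * (vg' - va) + d" "x \<le> x'" "vg \<le> w2" "w1 \<le> va'" for x x' vg vg' va va' d w1 w2 :: real
      using that by argo
    ultimately show ?thesis unfolding R_def \<Delta>_def by blast
  qed
  have "real (card Gd) * ln M0 = (\<Sum>p\<in>Gd. ln M0)" by simp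
  also have "\<dots> \<le> (\<Sum>p\<in>Gd. R p)" by (intro sum_mono gain)
  also have "\<dots> \<le> (\<Sum>p\<in>?T. R p)" using G R0 by (intro sum_mono2) auto
  also have "\<dots> = 2 * (\<Sum>p\<in>?T. \<Delta> (next2 w p div s)) + 2 * (\<Sum>p\<in>?T. \<Delta> (p div s)) + (\<Sum>p\<in>?T. \<Delta> (next_occ w p div s))
      + 2 * (\<Sum>p\<in>?T. log_max k w (next2 w p) - log_max k w p)"
    unfolding R_def by (simp add: sum.distrib sum_distrib_left)
  also have "\<dots> \<le> 2 * (real s * ?W) + 2 * (real s * ?W) + real s * ?W + 2 * (2 * real k * ?W)"
  proof (intro add_mono mult_left_mono)
    show "(\<Sum>p\<in>?T. \<Delta> (next2 w p div s)) \<le> real s * ?W" unfolding \<Delta>_def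
      using inj_triples[of w] triples[of _ w] s by (intro sum_cells[where V = V and n = "length w" and h = "next2 w"] V) auto
    show "(\<Sum>p\<in>?T. \<Delta> (p div s)) \<le> real s * ?W" unfolding \<Delta>_def
      using triples_lessThan[of w] s by (intro sum_cells[where V = V and n = "length w" and h = "\<lambda>p. p"] V) auto
    show "(\<Sum>p\<in>?T. \<Delta> (next_occ w p div s)) \<le> real s * ?W" unfolding \<Delta>_def
      using inj_triples[of w] triples[of _ w] s by (intro sum_cells[where V = V and n = "length w" and h = "next_occ w"] V) force+
    show "(\<Sum>p\<in>?T. log_max k w (next2 w p) - log_max k w p) \<le> 2 * real k * ?W"
      by (rule sum_next2_diff[OF w]) (auto simp: WG log_max_nonneg)
  qed auto
  finally show ?thesis by (simp add: algebra_simps)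
qed

section \<open>Lower bound\<close>

lemma card_le_fibres:
  assumes "finite A" and "\<And>x. x \<in> A \<Longrightarrow> real (card {y \<in> A. f y = f x}) \<le> M"
  shows "real (card A) \<le> real (card (f ` A)) * M"
proof -
  have "real (card A) = (\<Sum>x\<in>A. 1)" by simp
  also have "\<dots> = (\<Sum>y\<in>f ` A. real (card {x \<in> A. f x = y}))"
    by (subst sum.image_gen[OF assms(1), of _ f]) simp
  also have "\<dots> \<le> (\<Sum>y\<in>f ` A. M)" using assms(2) by (intro sum_mono) auto
  finally show ?thesis by simp
qed

text \<open>There are \<open>length w div s + 1\<close> choices for the first cell, and the other
  two lie at most \<open>D div s + 1\<close> cells after it.\<close>

lemma card_cells:
  assumes s: "s > 0" and A: "A \<subseteq> triples w" and D: "\<And>p. p \<in> A \<Longrightarrow> next2 w p \<le> p + D"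
  shows "card (cell s w ` A) \<le> (length w div s + 1) * (D div s + 2)\<^sup>2"
proof -
  have step: "q div s \<in> {p div s..p div s + (D div s + 1)}" if "p \<le> q" "q \<le> p + D" for p q
  proof -
    have "q div s \<le> (p + D) div s" using that by (simp add: div_le_mono)
    also have "\<dots> \<le> p div s + (D div s + 1)"
    proof (rule less_Suc_eq_le[THEN iffD1], rule less_mult_imp_div_less)
      have "p < Suc (p div s) * s" "D < Suc (D div s) * s" using dividend_less_div_times[of s] s by auto
      then show "p + D < Suc (p div s + (D div s + 1)) * s" by (simp add: algebra_simps)
    qed
    finally show ?thesis using that by (simp add: div_le_mono)
  qed
  have "cell s w ` A \<subseteq> Sigma {..length w div s} (\<lambda>a. {a..a + (D div s + 1)} \<times> {a..a + (D div s + 1)})"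
  proof
    fix c assume "c \<in> cell s w ` A"
    then obtain p where p: "p \<in> A" "c = cell s w p" by auto
    have t: "p < next_occ w p" "next_occ w p < next2 w p" "next2 w p < length w" using triples[of p w] p A by auto
    then have "p div s \<le> length w div s" by (intro div_le_mono) simp
    then show "c \<in> Sigma {..length w div s} (\<lambda>a. {a..a + (D div s + 1)} \<times> {a..a + (D div s + 1)})"
      using step[of p "next_occ w p"] step[of p "next2 w p"] t D[OF p(1)] by (simp add: p(2) cell_def)
  qed
  then have "card (cell s w ` A) \<le> card (Sigma {..length w div s} (\<lambda>a. {a..a + (D div s + 1)} \<times> {a..a + (D div s + 1)}))"
    by (intro card_mono) auto
  also have "\<dots> = (length w div s + 1) * (D div s + 2)\<^sup>2"
    by (simp add: card_cartesian_product power2_eq_square)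
  finally show ?thesis .
qed

text \<open>Three kinds of positions are discarded: those starting no triple, triples spanning more
  than about \<open>l * k\<close>, and triples in groups smaller than \<open>M0\<close>. Together
  they are at most a fraction \<open>4 / l\<close> of all positions.\<close>

lemma lower_log_large:
  assumes w: "set w \<subseteq> {1..k}" and n: "n = length w" and l: "l = ln (real k)" "l \<ge> 7" and nk: "real n \<ge> 2 * real k * l"
  shows "l / 4 - 2 * ln l - 3 \<le> real k / real n * log_max k w n"
proof -
  let ?T = "triples w" and ?W = "log_max k w n"
  have k0: "real k > 0" using l by (metis ln_0 of_nat_0_eq_iff of_nat_0_less_iff gr0I not_numeral_le_zero)
  then have lk: "l \<le> real k" using ln_le_minus_one[of "real k"] l by simp
  note l1 = l(1) and l = l(2)
  have n_k: "real k \<le> real n"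
  proof -
    have "real k * 1 \<le> real k * (2 * l)" using k0 l by (intro mult_left_mono) auto
    then show ?thesis using nk by (simp add: mult_ac)
  qed
  define s where "s = nat \<lceil>real k / l\<rceil>"
  have s1: "real k / l \<le> real s" unfolding s_def by (rule real_nat_ceiling_ge)
  have kl: "real k / l \<ge> 1" using lk l by (simp add: field_simps)
  have s0: "s > 0" using s1 kl by linarith
  have s2: "real s \<le> 2 * real k / l"
  proof -
    have "real s \<le> real k / l + 1" unfolding s_def using kl by linarith
    moreover have "2 * real k / l = real k / l + real k / l" by simp
    ultimately show ?thesis using kl by linarith
  qed
  define D where "D = nat \<lfloor>l * real k\<rfloor>"
  \<comment> \<open>There are at most \<open>8 * n * l ^ 5 / k\<close> groups, so with this
    threshold the small ones contain at most \<open>n / l\<close> triples.\<close>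
  define M0 where "M0 = real k / (8 * l ^ 6)"
  have M0: "M0 > 0" using k0 l by (simp add: M0_def)
  define A where "A = {p \<in> ?T. next2 w p \<le> p + D}"
  define Gd where "Gd = {p \<in> A. M0 \<le> real (card {q \<in> ?T. cell s w q = cell s w p})}"
  have fin: "finite A" "finite Gd" by (auto simp: A_def Gd_def)
  \<comment> \<open>Markov's inequality: by \<open>sum_next2_diff\<close> with \<open>g\<close> the
    position itself, all spans add up to at most \<open>2 * k * n\<close>.\<close>
  have far: "real (card (?T - A)) \<le> 2 * real n / l"
  proof -
    have "real (card (?T - A)) * (l * real k) = (\<Sum>p\<in>?T - A. l * real k)" by simp
    also have "\<dots> \<le> (\<Sum>p\<in>?T - A. real (next2 w p) - real p)"
    proof (rule sum_mono)
      fix p assume "p \<in> ?T - A"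
      then have "D < next2 w p - p" by (auto simp: A_def)
      then have "l * real k < real (next2 w p - p)" unfolding D_def using k0 l by linarith
      moreover have "real (next2 w p - p) = real (next2 w p) - real p"
        using \<open>D < next2 w p - p\<close> by (intro of_nat_diff) simp
      ultimately show "l * real k \<le> real (next2 w p) - real p" by linarith
    qed
    also have "\<dots> \<le> (\<Sum>p\<in>?T. real (next2 w p) - real p)"
      using triples(1,2)[of _ w] by (intro sum_mono2) (auto intro: less_imp_le less_trans)
    also have "\<dots> \<le> 2 * real k * real n" by (rule sum_next2_diff[OF w]) (auto simp: n)
    finally show ?thesis using k0 l by (simp add: field_simps)
  qed
  have bad: "real (card (A - Gd)) \<le> real n / l"
  proof -
    have "real (card (A - Gd)) \<le> real (card (cell s w ` (A - Gd))) * M0"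
    proof (rule card_le_fibres)
      fix p assume p: "p \<in> A - Gd"
      have "card {q \<in> A - Gd. cell s w q = cell s w p} \<le> card {q \<in> ?T. cell s w q = cell s w p}"
        by (intro card_mono) (auto simp: A_def)
      then show "real (card {q \<in> A - Gd. cell s w q = cell s w p}) \<le> M0" using p by (auto simp: Gd_def)
    qed (use fin in simp)
    also have "real (card (cell s w ` (A - Gd))) \<le> real ((n div s + 1) * (D div s + 2)\<^sup>2)"
      unfolding n of_nat_le_iff by (rule card_cells[OF s0]) (auto simp: A_def)
    also have "\<dots> \<le> (2 * real n * l / real k) * (2 * l\<^sup>2)\<^sup>2"
    proof -
      have "real (n div s) \<le> real n / real s" by (rule of_nat_div_le_of_nat)
      also have "\<dots> \<le> real n / (real k / l)" using s1 kl by (intro divide_left_mono mult_pos_pos) auto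
      finally have a: "real (n div s) \<le> real n * l / real k" by simp
      have b: "1 \<le> real n * l / real k"
        using n_k k0 l mult_mono[of "real k" "real n" 1 l] by (simp add: le_divide_eq)
      have c: "2 * real n * l / real k = real n * l / real k + real n * l / real k" by simp
      have 1: "real (n div s + 1) \<le> 2 * real n * l / real k"
        unfolding of_nat_add of_nat_1 c by (rule add_mono[OF a b])
      have "real (D div s) \<le> real D / real s" by (rule of_nat_div_le_of_nat)
      also have "\<dots> \<le> (l * real k) / (real k / l)" using s1 kl k0 l unfolding D_def
        by (intro frac_le) auto
      also have "\<dots> = l\<^sup>2" using k0 by (simp add: power2_eq_square)
      finally have "real (D div s + 2) \<le> l\<^sup>2 + 2" by simp
      also have "\<dots> \<le> 2 * l\<^sup>2" using l mult_mono[of 7 l 7 l] by (simp add: power2_eq_square)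
      finally have "(real (D div s + 2))\<^sup>2 \<le> (2 * l\<^sup>2)\<^sup>2" by (intro power_mono) auto
      then have "real (n div s + 1) * (real (D div s + 2))\<^sup>2 \<le> (2 * real n * l / real k) * (2 * l\<^sup>2)\<^sup>2"
        using 1 by (intro mult_mono) auto
      then show ?thesis by (simp only: of_nat_mult of_nat_power)
    qed
    finally have "real (card (A - Gd)) \<le> (2 * real n * l / real k) * (2 * l\<^sup>2)\<^sup>2 * M0"
      using M0 by simp
    also have "\<dots> = real n * (8 * l ^ 5 / real k * M0)" by (simp add: power_mult_distrib eval_nat_numeral)
    also have "8 * l ^ 5 / real k * M0 = 1 / l" using k0 l by (simp add: M0_def eval_nat_numeral)
    finally show ?thesis by simp
  qed
  have "card {..<n} \<le> card (({..<n} - ?T) \<union> (?T - A) \<union> (A - Gd) \<union> Gd)"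
    using fin by (intro card_mono) auto
  also have "\<dots> \<le> card ({..<n} - ?T) + card (?T - A) + card (A - Gd) + card Gd"
    by (meson add_mono card_Un_le le_refl order_trans)
  finally have "real n \<le> real (card ({..<n} - ?T)) + real (card (?T - A)) + real (card (A - Gd)) + real (card Gd)"
    by simp
  moreover have "real (card ({..<n} - ?T)) \<le> real n / l"
  proof -
    have "real (card ({..<n} - ?T)) * l \<le> real (2 * k) * l"
      using card_no_triple[OF w] l by (intro mult_right_mono) (simp_all add: n)
    also have "\<dots> \<le> real n" using nk by simp
    finally show ?thesis using l by (simp add: le_divide_eq)
  qed
  ultimately have "real n - 4 * real n / l \<le> real (card Gd)"
    using far bad by (simp add: add_divide_distrib)
  then have cg: "real n * (1 - 4 / l) \<le> real (card Gd)" by (simp add: algebra_simps)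
  have main: "real (card Gd) * ln M0 \<le> (4 * real k + 5 * real s) * ?W"
    unfolding n by (rule log_max_lower[OF w s0 _ M0]) (auto simp: Gd_def A_def)
  have W0: "0 \<le> ?W" by (rule log_max_nonneg)
  have l0: "l > 0" and ll: "ln l \<ge> 0" using l by auto
  have lnM0: "ln M0 = l - ln 8 - 6 * ln l"
    using k0 l0 by (simp add: M0_def ln_div ln_mult ln_realpow l1[symmetric])
  have ln8: "ln 8 \<le> (3::real)" using ln_realpow[of "2::real" 3] ln_2_less_1 by simp
  show ?thesis
  proof (cases "ln M0 \<ge> 0")
    \<comment> \<open>A negative \<open>ln M0\<close> means \<open>l < ln 8 + 6 * ln l\<close>, and
      then the claimed bound is not positive.\<close>
    case False
    then have "l / 4 - 2 * ln l - 3 \<le> 0" using ln8 ll unfolding lnM0 by argo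
    also have "0 \<le> real k / real n * ?W" using W0 by simp
    finally show ?thesis .
  next
    case True
    define U where "U = ln M0"
    have U: "0 \<le> U" "U \<le> l" using True lnM0 ll ln_ge_zero[of "8::real"] unfolding U_def by linarith+
    have n0: "real n > 0" using n_k k0 by linarith
    have "real n * (1 - 4 / l) * U \<le> (4 * real k + 5 * real s) * ?W"
      using main cg U mult_right_mono[OF cg U(1)] unfolding U_def by linarith
    also have "\<dots> \<le> (4 * real k + 5 * (2 * real k / l)) * ?W"
      using s2 W0 by (intro mult_right_mono add_mono mult_left_mono) auto
    also have "\<dots> = (4 + 10 / l) * (real k * ?W)" by (simp add: algebra_simps)
    finally have "(1 - 4 / l) * U \<le> (4 + 10 / l) * (real k / real n * ?W)"
      using n0 by (simp add: field_simps)
    \<comment> \<open>Multiplying out gives \<open>1 - 4 / l\<close> minus a positive term;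
      \<open>13 / 2\<close> is \<open>4 + 5 / 2\<close>, the first order loss in
      \<open>(1 - 4 / l) / (1 + 5 / (2 * l))\<close>.\<close>
    moreover have "(4 + 10 / l) * ((1 - 13 / (2 * l)) / 4 * U) \<le> (1 - 4 / l) * U"
    proof -
      have "(4 + 10 / l) * ((1 - 13 / (2 * l)) / 4) \<le> 1 - 4 / l"
        using l0 by (simp add: field_simps)
      then have "(4 + 10 / l) * ((1 - 13 / (2 * l)) / 4) * U \<le> (1 - 4 / l) * U"
        using U(1) by (rule mult_right_mono)
      then show ?thesis by (simp only: mult.assoc)
    qed
    ultimately have "(4 + 10 / l) * ((1 - 13 / (2 * l)) / 4 * U) \<le> (4 + 10 / l) * (real k / real n * ?W)"
      by linarith
    moreover have "4 + 10 / l > 0" using l0 by (simp add: add_pos_pos)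
    ultimately have "(1 - 13 / (2 * l)) / 4 * U \<le> real k / real n * ?W"
      using mult_le_cancel_left_pos by blast
    moreover have "(1 - 13 / (2 * l)) / 4 * U = U / 4 - 13 / 8 * (U / l)" using l0 by (simp add: field_simps)
    moreover have "U / l \<le> 1" using U l0 by simp
    ultimately have "U / 4 - 13 / 8 \<le> real k / real n * ?W" by linarith
    moreover have "U = l - ln 8 - 6 * ln l" by (simp add: U_def lnM0)
    ultimately show ?thesis using ln8 ll by argo
  qed
qed

lemma ln_2_ge_half: "1 / 2 \<le> ln (2::real)"
  using ln_le_minus_one[of "1 / 2 :: real"] by (simp add: ln_div)

text \<open>For \<open>ln k < 7\<close> the left side is not positive, since
  \<open>ln (ln k) \<ge> -1\<close> makes it at most \<open>7 / 4 + 2 - 4\<close>; this case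
  accounts for the constant 4 in place of 3.\<close>

lemma lower_log:
  assumes w: "set w \<subseteq> {1..k}" and n: "n = length w" and k: "k \<ge> 2" and nk: "real n \<ge> 2 * real k * ln (real k)"
  shows "ln (real k) / 4 - 2 * ln (ln (real k)) - 4 \<le> real k / real n * log_max k w n"
proof (cases "ln (real k) \<ge> 7")
  case True
  then show ?thesis using lower_log_large[OF w n refl True nk] by simp
next
  case False
  have "1 / 2 \<le> ln (2::real)" by (rule ln_2_ge_half)
  also have "\<dots> \<le> ln (real k)" using k by simp
  finally have "ln (1 / 2) \<le> ln (ln (real k))" by (intro ln_mono) auto
  then have "- 1 \<le> ln (ln (real k))" using ln_2_less_1 by (simp add: ln_div)
  then have "ln (real k) / 4 - 2 * ln (ln (real k)) - 4 \<le> 0" using False by argo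
  also have "0 \<le> real k / real n * log_max k w n" by (simp add: log_max_nonneg)
  finally show ?thesis .
qed

lemma min_max_maps_attained:
  assumes "k \<ge> 1"
  obtains w where "w \<in> words_of_length k n" "max_maps k w = min_max_maps k n"
proof -
  have "min_max_maps k n \<in> max_maps k ` words_of_length k n"
    unfolding min_max_maps_def using words_of_length_nonempty[OF assms]
    by (intro Min_in) (auto intro: finite_words_of_length)
  then show thesis using that by auto
qed

lemma min_max_maps_lower:
  assumes k: "k \<ge> 2" and nk: "real n \<ge> 2 * real k * ln (real k)"
  shows "1 / (exp 4 * (ln (real k))\<^sup>2) * real k powr (1/4) \<le> real (min_max_maps k n) powr (real k / real n)"
proof -
  obtain w where w: "w \<in> words_of_length k n" "max_maps k w = min_max_maps k n"
    using min_max_maps_attained[of k n] k by auto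
  have sw: "set w \<subseteq> {1..k}" "n = length w" using w by (auto simp: words_of_length_eq)
  have l0: "ln (real k) > 0" using k by simp
  have m1: "min_max_maps k n \<ge> 1" using max_maps_pos[of k w] w by simp
  have "1 / (exp 4 * (ln (real k))\<^sup>2) * real k powr (1/4) = exp (ln (real k) / 4 - 2 * ln (ln (real k)) - 4)"
  proof -
    have e: "exp (2 * ln (ln (real k))) = (ln (real k))\<^sup>2" using l0 by (simp add: exp_double)
    have p: "real k powr (1/4) = exp (ln (real k) / 4)" using k by (simp add: powr_def)
    show ?thesis unfolding exp_diff e p by simp
  qed
  also have "\<dots> \<le> exp (real k / real n * log_max k w n)"
    using lower_log[OF sw k nk] by simp
  also have "\<dots> = real (min_max_maps k n) powr (real k / real n)"
    using m1 sw w by (simp add: powr_def log_max_def)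
  finally show ?thesis .
qed

section \<open>Counting cuts\<close>

text \<open>The interval is half open, so empty intervals and single positions are always
  runs.\<close>

definition run :: "(nat \<Rightarrow> nat \<Rightarrow> nat) \<Rightarrow> nat \<Rightarrow> nat \<Rightarrow> nat \<Rightarrow> bool" where
  "run \<kappa> t x y \<longleftrightarrow> (\<forall>i j. x \<le> i \<longrightarrow> i < j \<longrightarrow> j < y \<longrightarrow> \<kappa> t i < \<kappa> t j)"

lemma run_sub: "run \<kappa> t x y \<Longrightarrow> x \<le> x' \<Longrightarrow> y' \<le> y \<Longrightarrow> run \<kappa> t x' y'"
  by (simp add: run_def)

lemma run_short [simp]: "y \<le> Suc x \<Longrightarrow> run \<kappa> t x y"
  by (auto simp: run_def)

lemma run_clamp: "run \<kappa> t x y \<Longrightarrow> (x' < y' \<Longrightarrow> x \<le> x' \<and> y' \<le> y) \<Longrightarrow> run \<kappa> t x' y'"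
  using run_sub[of \<kappa> t x y x' y'] by (cases "x' < y'") simp_all

text \<open>Jump greedily from \<open>x\<close> to the furthest \<open>Y x\<close>: the pairs starting inside one jump number at
  most the product of its length with the sum of its and the next jump's lengths, while the squared
  lengths of the jumps are paid for by disjoint spans.\<close>
lemma card_pairs_greedy:
  fixes \<phi> :: "nat \<Rightarrow> nat \<Rightarrow> bool" and p :: "nat \<Rightarrow> nat"
  assumes ce: "c \<le> e"
    and sub: "\<And>x y x' y'. \<lbrakk>\<phi> x y; c \<le> x; x \<le> x'; x' \<le> y'; y' \<le> y; y \<le> e\<rbrakk> \<Longrightarrow> \<phi> x' y'"
    and refl: "\<And>x. \<lbrakk>c \<le> x; x \<le> e\<rbrakk> \<Longrightarrow> \<phi> x x"
    and one: "\<And>x. \<lbrakk>c \<le> x; x < e\<rbrakk> \<Longrightarrow> \<phi> x (Suc x)"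
    and quad: "\<And>x y. \<lbrakk>\<phi> x y; c \<le> x; x < y; y \<le> e\<rbrakk> \<Longrightarrow> (y - x)\<^sup>2 + A * p x \<le> A * (p (y - 1) + 1)"
    and mono: "\<And>i j. \<lbrakk>c \<le> i; i < j; j < e\<rbrakk> \<Longrightarrow> p i < p j"
    and bd: "\<And>i. i < e \<Longrightarrow> p i < R"
  shows "card {(x, y). c \<le> x \<and> x \<le> y \<and> y \<le> e \<and> \<phi> x y} \<le> 4 * A * R + 1"
proof -
  define Y where "Y x = Max {y. x \<le> y \<and> y \<le> e \<and> \<phi> x y}" for x
  have Yin: "x \<le> Y x" "Y x \<le> e" "\<phi> x (Y x)" if "c \<le> x" "x \<le> e" for x
  proof -
    have "Y x \<in> {y. x \<le> y \<and> y \<le> e \<and> \<phi> x y}" unfolding Y_def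
      using refl that by (intro Max_in) auto
    then show "x \<le> Y x" "Y x \<le> e" "\<phi> x (Y x)" by auto
  qed
  have Yge: "y \<le> Y x" if "x \<le> y" "y \<le> e" "\<phi> x y" for x y
    unfolding Y_def using that by (intro Max_ge) auto
  have set_eq: "{y. x \<le> y \<and> y \<le> e \<and> \<phi> x y} = {x..Y x}" if "c \<le> x" "x \<le> e" for x
    using Yin[OF that] Yge sub[of x "Y x" x] that by auto
  define S where "S x0 = (\<Sum>x=x0..e. Y x - x + 1)" for x0
  have Ye: "Y e = e" using Yin[of e] ce by simp
  have Se: "S e = 1" by (simp add: S_def Ye)
  \<comment> \<open>The square of the current jump is part of the claim because the pairs starting
    in the preceding jump are charged partly to it. The factor 4 is 3 from counting pairs plus 1 for
    that square.\<close>
  have main: "S x0 + (Y x0 - x0)\<^sup>2 + 4 * A * p x0 \<le> 4 * A * (p (e - 1) + 1) + 1" if "c \<le> x0" "x0 < e" for x0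
    using that
  proof (induction "e - x0" arbitrary: x0 rule: less_induct)
    case less
    define x1 where "x1 = Y x0"
    have x1: "x0 < x1" "x1 \<le> e" using Yge[of x0 "Suc x0"] one[of x0] Yin[of x0] less.prems by (auto simp: x1_def)
    define l0 l1 where "l0 = x1 - x0" and "l1 = Y x1 - x1"
    have Yx1: "x1 \<le> Y x1" "Y x1 \<le> e" using Yin[of x1] less.prems x1 by auto
    \<comment> \<open>By heredity of \<open>\<phi>\<close>, a jump from inside the present one
      cannot pass the end of the next.\<close>
    have Ymono: "Y x \<le> Y x1" if "x0 \<le> x" "x < x1" for x
    proof -
      have "\<phi> x x1" using sub[of x0 x1 x x1] Yin[of x0] less.prems that x1 by (auto simp: x1_def)
      then have "x1 \<le> Y x" using that x1 by (intro Yge) auto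
      then have "\<phi> x1 (Y x)" using sub[of x "Y x" x1 "Y x"] Yin[of x] that x1 less.prems by auto
      then show ?thesis using Yge[of x1 "Y x"] \<open>x1 \<le> Y x\<close> Yin[of x] that x1 less.prems by auto
    qed
    have "(\<Sum>x\<in>{x0..<x1}. Y x - x + 1) \<le> (\<Sum>x\<in>{x0..<x1}. l0 + l1 + 1)"
    proof (intro sum_mono)
      fix x assume "x \<in> {x0..<x1}"
      then have "Y x - x \<le> Y x - x0" and "Y x - x0 \<le> Y x1 - x0"
        using Ymono[of x] by (simp_all add: diff_le_mono diff_le_mono2)
      then have "Y x - x \<le> Y x1 - x0" by (rule le_trans)
      also have "Y x1 - x0 = l0 + l1" using x1(1) Yx1(1) unfolding l0_def l1_def by linarith
      finally show "Y x - x + 1 \<le> l0 + l1 + 1" by simp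
    qed
    also have "\<dots> = l0 * (l0 + l1 + 1)" by (simp add: l0_def[symmetric])
    finally have 1: "(\<Sum>x\<in>{x0..<x1}. Y x - x + 1) \<le> l0 * (l0 + l1 + 1)" .
    have "{x0..e} = {x0..<x1} \<union> {x1..e}" using x1 by auto
    moreover have "{x0..<x1} \<inter> {x1..e} = {}" by auto
    ultimately have 2: "S x0 = (\<Sum>x\<in>{x0..<x1}. Y x - x + 1) + S x1"
      unfolding S_def by (simp only: sum.union_disjoint finite_atLeastLessThan finite_atLeastAtMost)
    have "l0 * l1 \<le> l0\<^sup>2 + l1\<^sup>2"
    proof (cases "l0 \<le> l1")
      case True then have "l0 * l1 \<le> l1 * l1" by simp
      then show ?thesis by (simp add: power2_eq_square trans_le_add2)
    next
      case False then have "l0 * l1 \<le> l0 * l0" by simp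
      then show ?thesis by (simp add: power2_eq_square trans_le_add1)
    qed
    moreover have "l0 \<le> l0\<^sup>2" by (simp add: power2_eq_square)
    moreover have "l0 * (l0 + l1 + 1) = l0\<^sup>2 + l0 * l1 + l0" by (simp add: algebra_simps power2_eq_square)
    ultimately have 3: "l0 * (l0 + l1 + 1) \<le> 3 * l0\<^sup>2 + l1\<^sup>2" by linarith
    have 4: "l0\<^sup>2 + A * p x0 \<le> A * (p (x1 - 1) + 1)"
      unfolding l0_def using quad[of x0 x1] Yin[of x0] x1 less.prems by (simp add: x1_def)
    have 5: "S x0 + (Y x0 - x0)\<^sup>2 \<le> 4 * l0\<^sup>2 + l1\<^sup>2 + S x1"
      using 1 2 3 by (simp add: l0_def[symmetric] x1_def[symmetric])
    show ?case
    proof (cases "x1 = e")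
      case True
      then show ?thesis using 5 4 Se Ye by (simp add: l1_def algebra_simps)
    next
      case False
      then have "S x1 + l1\<^sup>2 + 4 * A * p x1 \<le> 4 * A * (p (e - 1) + 1) + 1"
        unfolding l1_def using less.hyps[of x1] x1 less.prems by simp
      moreover have "A * (p (x1 - 1) + 1) \<le> A * p x1"
      proof (intro mult_le_mono2)
        have "p (x1 - 1) < p x1" using x1 False less.prems by (intro mono) linarith+
        then show "p (x1 - 1) + 1 \<le> p x1" by simp
      qed
      ultimately show ?thesis using 5 4 by linarith
    qed
  qed
  have "card {(x, y). c \<le> x \<and> x \<le> y \<and> y \<le> e \<and> \<phi> x y} = card (Sigma {c..e} (\<lambda>x. {y. x \<le> y \<and> y \<le> e \<and> \<phi> x y}))"
    by (rule arg_cong[where f = card]) auto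
  also have "\<dots> = (\<Sum>x=c..e. card {y. x \<le> y \<and> y \<le> e \<and> \<phi> x y})" by (rule card_SigmaI) auto
  also have "\<dots> = S c" unfolding S_def by (rule sum.cong) (auto simp: set_eq Yin Suc_diff_le)
  also have "\<dots> \<le> 4 * A * R + 1"
  proof (cases "c = e")
    case False
    then have "S c \<le> 4 * A * (p (e - 1) + 1) + 1" using main[of c] ce by simp
    also have "\<dots> \<le> 4 * A * R + 1" using bd[of "e - 1"] False ce by (intro add_mono mult_le_mono2) auto
    finally show ?thesis .
  qed (simp add: Se)
  finally show ?thesis .
qed

lemma card_le_diameter:
  fixes S :: "nat set"
  assumes "\<And>x y. x \<in> S \<Longrightarrow> y \<in> S \<Longrightarrow> y \<le> x + d"
  shows "finite S" "card S \<le> d + 1"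
proof -
  have "finite S \<and> card S \<le> d + 1"
  proof (cases "S = {}")
    case False
    define x where "x = (LEAST x. x \<in> S)"
    have "x \<in> S" unfolding x_def using False by (auto intro: LeastI)
    have "S \<subseteq> {x..x + d}"
    proof
      fix y assume "y \<in> S"
      then show "y \<in> {x..x + d}"
        using assms[OF \<open>x \<in> S\<close>] Least_le[of "\<lambda>x. x \<in> S" y] unfolding x_def by simp
    qed
    then show ?thesis using card_mono[of "{x..x + d}" S] finite_subset[of S "{x..x + d}"] by simp
  qed simp
  then show "finite S" "card S \<le> d + 1" by auto
qed

text \<open>\<open>\<kappa> t i\<close> is the rank, in the \<open>t\<close>-th block, of the \<open>i\<close>-th letter of a fixed word of length \<open>m\<close>.\<close>
locale run_system =
  fixes \<kappa> :: "nat \<Rightarrow> nat \<Rightarrow> nat" and m K :: nat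
  assumes K: "K \<ge> 1"
    and bound: "i < m \<Longrightarrow> \<kappa> t i < K ^ 4"
    and adjacent: "\<lbrakk>run \<kappa> t x y; run \<kappa> (t + d) x y; d = 1 \<or> d = 3; x \<le> y; y \<le> m\<rbrakk> \<Longrightarrow> y \<le> x + K"
    and opposite: "\<lbrakk>run \<kappa> t x y; run \<kappa> (t + 2) x y; x \<le> y; y \<le> m\<rbrakk> \<Longrightarrow> y \<le> x + K\<^sup>2"
    and three: "\<lbrakk>run \<kappa> t x y; run \<kappa> (t + d) x y; run \<kappa> (t + d') x y; 0 < d; d < d'; d' < 4; x \<le> y; y \<le> m\<rbrakk>
      \<Longrightarrow> y \<le> x + 1"
    and span: "\<lbrakk>run \<kappa> t x y; run \<kappa> (t + d) x y; 0 < d; d < 4; x < y; y \<le> m\<rbrakk>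
      \<Longrightarrow> (y - x)\<^sup>2 + 64 * \<kappa> t x \<le> 64 * (\<kappa> t (y - 1) + 1)"
begin

text \<open>Let \<open>z\<close> be the earliest start, from \<open>c\<close> on, of a run of kind
  \<open>t + 2\<close> up to \<open>e\<close>; then \<open>e - z \<le> K\<^sup>2\<close>. With
  \<open>y\<close> equal to \<open>z\<close> or \<open>Suc z\<close> there are at most
  \<open>K + 1\<close> choices of \<open>x\<close>. For later \<open>y\<close> the three runs
  overlap in \<open>{max x z..<y}\<close>, which leaves only \<open>y - 1\<close> and
  \<open>y\<close> for \<open>x\<close>.\<close>

lemma card_two_runs:
  assumes e: "c \<le> e" "e \<le> m" "run \<kappa> t c e"
  shows "card {(x, y). c \<le> x \<and> x \<le> y \<and> y \<le> e \<and> run \<kappa> (t + 1) x y \<and> run \<kappa> (t + 2) y e} \<le> 8 * K\<^sup>2"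
proof -
  let ?S = "{(x, y). c \<le> x \<and> x \<le> y \<and> y \<le> e \<and> run \<kappa> (t + 1) x y \<and> run \<kappa> (t + 2) y e}"
  define z where "z = (LEAST z. c \<le> z \<and> run \<kappa> (t + 2) z e)"
  have z: "c \<le> z" "run \<kappa> (t + 2) z e"
    using LeastI[of "\<lambda>z. c \<le> z \<and> run \<kappa> (t + 2) z e" e] e by (auto simp: z_def)
  have zle: "z \<le> y" if "c \<le> y" "run \<kappa> (t + 2) y e" for y
    unfolding z_def using that by (intro Least_le) auto
  have ze: "z \<le> e" using zle[of e] e by simp
  have zK: "e \<le> z + K\<^sup>2" using opposite[of t z e] run_sub[OF e(3) z(1)] z ze e by simp
  let ?A = "(\<Union>y\<in>{z, Suc z}. {y - K..y} \<times> {y})" and ?B = "(\<Union>y\<in>{z..z + K\<^sup>2}. {y - 1, y} \<times> {y})"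
  have "?S \<subseteq> ?A \<union> ?B"
  proof (clarify)
    fix x y assume h: "c \<le> x" "x \<le> y" "y \<le> e" "run \<kappa> (t + 1) x y" "run \<kappa> (t + 2) y e"
      and nB: "(x, y) \<notin> ?B"
    have zy: "z \<le> y" using zle h by simp
    have "y \<le> x + K" using adjacent[of t x y 1] run_sub[OF e(3) h(1) h(3)] h(2-4) e(2) by simp
    moreover have "y = z \<or> y = Suc z"
    proof (rule ccontr)
      assume ne: "\<not> ?thesis"
      define x' where "x' = max x z"
      have "y \<le> x' + 1"
      proof (rule three[of t x' y 1 2])
        show "run \<kappa> t x' y" using h by (intro run_sub[OF e(3)]) (simp_all add: x'_def)
        show "run \<kappa> (t + 1) x' y" by (intro run_sub[OF h(4)]) (simp_all add: x'_def)
        show "run \<kappa> (t + 2) x' y" using h by (intro run_sub[OF z(2)]) (simp_all add: x'_def)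
      qed (use h e zy in \<open>simp_all add: x'_def\<close>)
      then have "x = y - 1 \<or> x = y" using ne zy h(2) unfolding x'_def by linarith
      moreover have "y \<le> z + K\<^sup>2" using h(3) zK by simp
      ultimately show False using nB zy by auto
    qed
    ultimately show "(x, y) \<in> ?A" using h(2) by auto
  qed
  then have "card ?S \<le> card (?A \<union> ?B)" by (intro card_mono) auto
  also have "\<dots> \<le> card ?A + card ?B" by (rule card_Un_le)
  also have "card ?A \<le> (\<Sum>y\<in>{z, Suc z}. card ({y - K..y} \<times> {y}))" by (rule card_UN_le) simp
  also have "\<dots> \<le> (\<Sum>y\<in>{z, Suc z}. K + 1)" by (rule sum_mono) (simp add: card_cartesian_product)
  also have "\<dots> = 2 * (K + 1)" by simp
  also have "card ?B \<le> (\<Sum>y\<in>{z..z + K\<^sup>2}. card ({y - 1, y} \<times> {y}))" by (rule card_UN_le) simp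
  also have "\<dots> \<le> (\<Sum>y\<in>{z..z + K\<^sup>2}. 2)" by (rule sum_mono) (simp add: card_cartesian_product card_insert_if)
  also have "\<dots> = 2 * (K\<^sup>2 + 1)" by simp
  finally have "card ?S \<le> 2 * (K + 1) + 2 * (K\<^sup>2 + 1)" by simp
  moreover have "K \<le> K\<^sup>2" "1 \<le> K\<^sup>2" using K by (simp_all add: power2_eq_square)
  ultimately show ?thesis by simp
qed

text \<open>Kinds \<open>t\<close> and \<open>t + 3\<close> are neighbours in the cycle, so
  \<open>u\<close> has at most \<open>K + 1\<close> values; for each, \<open>card_two_runs\<close>
  applies with \<open>u\<close> in place of \<open>e\<close>.\<close>

lemma card_three_runs:
  assumes e: "c \<le> e" "e \<le> m" "run \<kappa> t c e"
  shows "card {((x, y), u). c \<le> x \<and> x \<le> y \<and> y \<le> u \<and> u \<le> e \<and> run \<kappa> (t + 1) x y \<and> run \<kappa> (t + 2) y u \<and> run \<kappa> (t + 3) u e}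
    \<le> 16 * K ^ 3"
proof -
  let ?S = "{((x, y), u). c \<le> x \<and> x \<le> y \<and> y \<le> u \<and> u \<le> e \<and> run \<kappa> (t + 1) x y \<and> run \<kappa> (t + 2) y u \<and> run \<kappa> (t + 3) u e}"
  let ?P = "\<lambda>u. {(x, y). c \<le> x \<and> x \<le> y \<and> y \<le> u \<and> run \<kappa> (t + 1) x y \<and> run \<kappa> (t + 2) y u}"
  have fin: "finite (?P u)" for u
    by (rule finite_subset[of _ "{..u} \<times> {..u}"]) auto
  let ?U = "{u. c \<le> u \<and> u \<le> e \<and> run \<kappa> (t + 3) u e}"
  have "?U \<subseteq> {e - K..e}"
    using adjacent[of t _ e 3] run_sub[OF e(3)] e by fastforce
  then have U: "card ?U \<le> K + 1" "finite ?U" using card_mono[of "{e - K..e}" ?U] finite_subset by auto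
  have "?S = (\<Union>u\<in>?U. ?P u \<times> {u})" by auto
  then have "card ?S \<le> (\<Sum>u\<in>?U. card (?P u \<times> {u}))" using card_UN_le[OF U(2)] by metis
  also have "\<dots> = (\<Sum>u\<in>?U. card (?P u))" by (simp add: card_cartesian_product)
  also have "\<dots> \<le> (\<Sum>u\<in>?U. 8 * K\<^sup>2)"
    using card_two_runs[of c _ t] run_sub[OF e(3)] e by (intro sum_mono) auto
  also have "\<dots> \<le> (K + 1) * (8 * K\<^sup>2)" using mult_le_mono1[OF U(1), of "8 * K\<^sup>2"] by simp
  also have "\<dots> \<le> (2 * K) * (8 * K\<^sup>2)" using K by (intro mult_le_mono1) simp
  finally show ?thesis by (simp add: power2_eq_square power3_eq_cube)
qed

text \<open>The outer cuts \<open>x\<close> and \<open>v\<close> are counted by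
  \<open>card_pairs_greedy\<close>; once they are fixed, the inner cuts take at most three values
  each. The constant is \<open>9 * (4 * 192 + 1)\<close>.\<close>

lemma card_four_runs:
  assumes e: "c \<le> e" "e \<le> m" "run \<kappa> t c e"
  shows "card {(((x, y), u), v). c \<le> x \<and> x \<le> y \<and> y \<le> u \<and> u \<le> v \<and> v \<le> e \<and>
     run \<kappa> (t + 1) x y \<and> run \<kappa> (t + 2) y u \<and> run \<kappa> (t + 3) u v} \<le> 6921 * K ^ 4"
proof -
  let ?C = "\<lambda>x y u v. x \<le> y \<and> y \<le> u \<and> u \<le> v \<and> run \<kappa> (t + 1) x y \<and> run \<kappa> (t + 2) y u \<and> run \<kappa> (t + 3) u v"
  let ?S = "{(((x, y), u), v). c \<le> x \<and> x \<le> y \<and> y \<le> u \<and> u \<le> v \<and> v \<le> e \<and>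
     run \<kappa> (t + 1) x y \<and> run \<kappa> (t + 2) y u \<and> run \<kappa> (t + 3) u v}"
  define \<phi> where "\<phi> x v \<longleftrightarrow> (\<exists>y u. ?C x y u v)" for x v
  have mono: "\<kappa> t i < \<kappa> t j" if "c \<le> i" "i < j" "j < e" for i j using e(3) that by (auto simp: run_def)
  have sq: "(a + b + g)\<^sup>2 \<le> 3 * (a\<^sup>2 + b\<^sup>2 + g\<^sup>2)" for a b g :: nat
  proof -
    have "0 \<le> (int a - int b)\<^sup>2 + (int b - int g)\<^sup>2 + (int a - int g)\<^sup>2" by simp
    then have "(int a + int b + int g)\<^sup>2 \<le> 3 * ((int a)\<^sup>2 + (int b)\<^sup>2 + (int g)\<^sup>2)"
      by (simp add: power2_eq_square algebra_simps)
    then have "int ((a + b + g)\<^sup>2) \<le> int (3 * (a\<^sup>2 + b\<^sup>2 + g\<^sup>2))" by simp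
    then show ?thesis by (simp only: of_nat_le_iff)
  qed
  \<comment> \<open>\<open>192 = 3 * 64\<close>: the interval consists of three runs, each
    satisfying the spread inequality with 64, and squaring their total length costs a factor
    3.\<close>
  have pairs: "card {(x, v). c \<le> x \<and> x \<le> v \<and> v \<le> e \<and> \<phi> x v} \<le> 4 * 192 * K ^ 4 + 1"
  proof (rule card_pairs_greedy[where p = "\<kappa> t"])
    fix x v x' v' assume h: "\<phi> x v" "c \<le> x" "x \<le> x'" "x' \<le> v'" "v' \<le> v" "v \<le> e"
    then obtain y u where yu: "?C x y u v" by (auto simp: \<phi>_def)
    have r: "run \<kappa> (t + 1) x y" "run \<kappa> (t + 2) y u" "run \<kappa> (t + 3) u v" using yu by blast+
    have "?C x' (max x' (min y v')) (max x' (min u v')) v'"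
    proof (intro conjI)
      show "run \<kappa> (t + 1) x' (max x' (min y v'))"
        by (rule run_clamp[OF r(1)]) (use h in linarith)
      show "run \<kappa> (t + 2) (max x' (min y v')) (max x' (min u v'))"
        by (rule run_clamp[OF r(2)]) (use h yu in linarith)
      show "run \<kappa> (t + 3) (max x' (min u v')) v'"
        by (rule run_clamp[OF r(3)]) (use h yu in linarith)
    qed (use h yu in linarith)+
    then show "\<phi> x' v'" unfolding \<phi>_def by blast
  next
    fix x assume "c \<le> x" "x \<le> e"
    have "?C x x x x" by simp
    then show "\<phi> x x" unfolding \<phi>_def by blast
  next
    fix x assume "c \<le> x" "x < e"
    have "?C x x x (Suc x)" by simp
    then show "\<phi> x (Suc x)" unfolding \<phi>_def by blast
  next
    fix x v assume h: "\<phi> x v" "c \<le> x" "x < v" "v \<le> e"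
    then obtain y u where yu: "?C x y u v" by (auto simp: \<phi>_def)
    \<comment> \<open>The ranks with an artificial value at the end \<open>v\<close>, so that the
      three spread inequalities telescope even if some of the runs are empty.\<close>
    define q where "q i = (if i = v then \<kappa> t (v - 1) + 1 else \<kappa> t i)" for i
    have q: "(b - a)\<^sup>2 + 64 * q a \<le> 64 * q b" if "x \<le> a" "a \<le> b" "b \<le> v" "run \<kappa> (t + d) a b" "0 < d" "d < 4" for a b d
    proof (cases "a = b")
      case False
      then have "(b - a)\<^sup>2 + 64 * \<kappa> t a \<le> 64 * (\<kappa> t (b - 1) + 1)"
        using that h e run_sub[OF e(3), of a b] by (intro span[of t a b d]) auto
      moreover have "\<kappa> t (b - 1) + 1 \<le> q b"
      proof (cases "b = v")
        case False
        moreover have "\<kappa> t (b - 1) < \<kappa> t b" using that h False \<open>a \<noteq> b\<close> by (intro mono) auto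
        ultimately show ?thesis by (simp add: q_def)
      qed (simp add: q_def)
      moreover have "q a = \<kappa> t a" using False that by (simp add: q_def)
      moreover have "l + 64 * A \<le> 64 * B" if "l + 64 * A' \<le> 64 * B'" "B' \<le> B" "A = A'" for l A A' B B' :: nat
        using that by linarith
      ultimately show ?thesis by blast
    qed simp
    have "(v - x)\<^sup>2 = ((y - x) + (u - y) + (v - u))\<^sup>2" using yu by simp
    also have "\<dots> \<le> 3 * ((y - x)\<^sup>2 + (u - y)\<^sup>2 + (v - u)\<^sup>2)" by (rule sq)
    finally have "(v - x)\<^sup>2 \<le> 3 * ((y - x)\<^sup>2 + (u - y)\<^sup>2 + (v - u)\<^sup>2)" .
    moreover have "(y - x)\<^sup>2 + 64 * q x \<le> 64 * q y" using q[of x y 1] yu by auto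
    moreover have "(u - y)\<^sup>2 + 64 * q y \<le> 64 * q u" using q[of y u 2] yu by auto
    moreover have "(v - u)\<^sup>2 + 64 * q u \<le> 64 * q v" using q[of u v 3] yu by auto
    moreover have "q x = \<kappa> t x" "q v = \<kappa> t (v - 1) + 1" using h by (auto simp: q_def)
    moreover have "L + 192 * A' \<le> 192 * D'"
      if "L \<le> 3 * (l + l' + l'')" "l + 64 * A \<le> 64 * B" "l' + 64 * B \<le> 64 * C" "l'' + 64 * C \<le> 64 * D" "A = A'" "D = D'"
      for L l l' l'' A A' B C D D' :: nat using that unfolding distrib_left by linarith
    ultimately show "(v - x)\<^sup>2 + 192 * \<kappa> t x \<le> 192 * (\<kappa> t (v - 1) + 1)" by blast
  qed (use mono bound e in auto)
  let ?P = "{(x, v). c \<le> x \<and> x \<le> v \<and> v \<le> e \<and> \<phi> x v}"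
  let ?F = "\<lambda>x v. {(y, u). ?C x y u v}"
  have finP: "finite ?P" by (rule finite_subset[of _ "{..e} \<times> {..e}"]) auto
  have fibre: "finite (?F x v) \<and> card (?F x v) \<le> 9" if xv: "c \<le> x" "v \<le> e" for x v
  proof -
    have tr: "b \<le> a + 1" if "run \<kappa> (t + d) a b" "run \<kappa> (t + d') a b" "0 < d" "d < d'" "d' < 4" "c \<le> a" "b \<le> e" for a b d d'
    proof (cases "a \<le> b")
      case True
      then show ?thesis using three[of t a b d d'] run_sub[OF e(3)] that e by auto
    qed simp
    \<comment> \<open>From \<open>y\<close> to \<open>min y' u\<close> there is a common run of kind
      \<open>t\<close>, kind \<open>t + 1\<close> of the second chain and kind \<open>t + 2\<close>
      of the first; from \<open>u\<close> to \<open>y'\<close>, kind \<open>t + 3\<close> of the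
      first chain replaces \<open>t + 2\<close>. Each overlap has length at most 1.\<close>
    have y: "y' \<le> y + 2" if h: "?C x y u v" "?C x y' u' v" for y u y' u'
    proof (cases "y \<le> y'")
      case True
      have le: "x \<le> y" "y \<le> u" "u \<le> v" "y' \<le> u'" "u' \<le> v" and r: "run \<kappa> (t + 2) y u" "run \<kappa> (t + 3) u v" "run \<kappa> (t + 1) x y'"
        using h by blast+
      have 1: "min y' u \<le> y + 1"
        by (rule tr[of 1 y "min y' u" 2, OF run_clamp[OF r(3)] run_clamp[OF r(1)]]) (use le xv in linarith)+
      have 2: "y' \<le> u + 1"
        by (rule tr[of 1 u y' 3, OF run_clamp[OF r(3)] run_clamp[OF r(2)]]) (use le xv in linarith)+
      show ?thesis using 1 2 by linarith
    qed simp
    have u: "u' \<le> u + 2" if h: "?C x y u v" "?C x y' u' v" for y u y' u'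
    proof (cases "u \<le> u'")
      case True
      have le: "x \<le> y" "y \<le> u" "u \<le> v" "y' \<le> u'" "u' \<le> v"
        and r: "run \<kappa> (t + 2) y' u'" "run \<kappa> (t + 3) u v" "run \<kappa> (t + 1) x y'"
        using h by blast+
      have 1: "u' \<le> max u y' + 1"
        by (rule tr[of 2 "max u y'" u' 3, OF run_clamp[OF r(1)] run_clamp[OF r(2)]]) (use le xv in linarith)+
      have 2: "y' \<le> u + 1"
        by (rule tr[of 1 u y' 3, OF run_clamp[OF r(3)] run_clamp[OF r(2)]]) (use le xv in linarith)+
      show ?thesis using 1 2 by linarith
    qed simp
    define Fy Fu where "Fy = fst ` ?F x v" and "Fu = snd ` ?F x v"
    have Fy: "finite Fy" "card Fy \<le> 2 + 1"
    proof (rule_tac [!] card_le_diameter)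
      show "b \<le> a + 2" if "a \<in> Fy" "b \<in> Fy" for a b using that y unfolding Fy_def by auto
      then show "b \<le> a + 2" if "a \<in> Fy" "b \<in> Fy" for a b using that by blast
    qed
    have Fu: "finite Fu" "card Fu \<le> 2 + 1"
    proof (rule_tac [!] card_le_diameter)
      show "b \<le> a + 2" if "a \<in> Fu" "b \<in> Fu" for a b using that u unfolding Fu_def by auto
      then show "b \<le> a + 2" if "a \<in> Fu" "b \<in> Fu" for a b using that by blast
    qed
    have sub: "?F x v \<subseteq> Fy \<times> Fu" unfolding Fy_def Fu_def by force
    have fin: "finite (Fy \<times> Fu)" by (intro finite_cartesian_product Fy Fu)
    have "finite (?F x v)" by (rule finite_subset[OF sub fin])
    moreover have "card (?F x v) \<le> card Fy * card Fu"
      using card_mono[OF fin sub] by (simp only: card_cartesian_product)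
    moreover have "card Fy * card Fu \<le> 3 * 3" using Fy Fu by (intro mult_le_mono) auto
    ultimately show ?thesis by linarith
  qed
  define G where "G = Sigma ?P (\<lambda>(x, v). ?F x v)"
  have G: "finite G" "card G \<le> 9 * card ?P"
  proof -
    have fb: "finite (case q of (x, v) \<Rightarrow> ?F x v) \<and> card (case q of (x, v) \<Rightarrow> ?F x v) \<le> 9" if "q \<in> ?P" for q
      using that fibre by (cases q) auto
    show "finite G" unfolding G_def using finP fb by (intro finite_SigmaI) blast+
    have "card G = (\<Sum>q\<in>?P. card (case q of (x, v) \<Rightarrow> ?F x v))"
      unfolding G_def using finP fb by (intro card_SigmaI) blast+
    also have "\<dots> \<le> (\<Sum>q\<in>?P. 9)" using fb by (intro sum_mono) blast
    finally show "card G \<le> 9 * card ?P" by simp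
  qed
  have "?S \<subseteq> (\<lambda>((x, v), (y, u)). (((x, y), u), v)) ` G"
  proof
    fix s assume "s \<in> ?S"
    then obtain x y u v where s: "s = (((x, y), u), v)" "c \<le> x" "v \<le> e" "?C x y u v" by auto
    then have "((x, v), (y, u)) \<in> G" unfolding G_def \<phi>_def by auto
    then show "s \<in> (\<lambda>((x, v), (y, u)). (((x, y), u), v)) ` G" using s by force
  qed
  then have "card ?S \<le> card ((\<lambda>((x, v), (y, u)). (((x, y), u), v)) ` G)"
    using G by (intro card_mono) auto
  also have "\<dots> \<le> card G" using G by (intro card_image_le) auto
  also have "\<dots> \<le> 9 * (4 * 192 * K ^ 4 + 1)" using G(2) mult_le_mono2[OF pairs, of 9] by (rule le_trans)
  also have "\<dots> \<le> 6921 * K ^ 4"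
  proof -
    define a where "a = K ^ 4"
    have "1 \<le> a" unfolding a_def by (rule one_le_power[OF K])
    then have "9 * (4 * 192 * a + 1) \<le> 6921 * a" by simp
    then show ?thesis unfolding a_def .
  qed
  finally show ?thesis .
qed

section \<open>Recursion for the number of ways to cut a word into runs\<close>

definition cuts :: "nat \<Rightarrow> nat \<Rightarrow> nat set" where
  "cuts t c = {c'. c \<le> c' \<and> c' \<le> m \<and> run \<kappa> t c c'}"

text \<open>The number of ways to cut the word from \<open>c\<close> on into \<open>r\<close> runs,
  possibly empty, of the kinds \<open>t\<close>, \<open>t + 1\<close> and so on, with nothing left
  over.\<close>

primrec paths :: "nat \<Rightarrow> nat \<Rightarrow> nat \<Rightarrow> nat" where
  "paths 0 t c = (if c = m then 1 else 0)"
| "paths (Suc r) t c = (\<Sum>c'\<in>cuts t c. paths r (Suc t) c')"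

lemma finite_cuts [simp]: "finite (cuts t c)"
  unfolding cuts_def by (rule finite_subset[of _ "{..m}"]) auto

lemma run_length: "run \<kappa> t x y \<Longrightarrow> x \<le> y \<Longrightarrow> y \<le> m \<Longrightarrow> y \<le> x + K ^ 4"
proof -
  assume r: "run \<kappa> t x y" "x \<le> y" "y \<le> m"
  have "inj_on (\<kappa> t) {x..<y}"
  proof (rule inj_onI, rule ccontr)
    fix i j assume "i \<in> {x..<y}" "j \<in> {x..<y}" "\<kappa> t i = \<kappa> t j" "i \<noteq> j"
    then show False using r(1) unfolding run_def
      by (metis atLeastLessThan_iff linorder_neqE_nat nat_neq_iff)
  qed
  moreover have "\<kappa> t ` {x..<y} \<subseteq> {..<K ^ 4}" using bound r by auto
  ultimately have "card {x..<y} \<le> card {..<K ^ 4}" by (intro card_inj_on_le) auto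
  then show ?thesis by simp
qed

lemma card_cuts: "card (cuts t c) \<le> K ^ 4 + 1"
proof -
  have "cuts t c \<subseteq> {c..c + K ^ 4}" using run_length by (auto simp: cuts_def)
  then have "card (cuts t c) \<le> card {c..c + K ^ 4}" by (intro card_mono) auto
  then show ?thesis by simp
qed

lemma paths_trivial: "paths r t c \<le> (K ^ 4 + 1) ^ r"
proof (induction r arbitrary: t c)
  case (Suc r)
  have "paths (Suc r) t c \<le> (\<Sum>c'\<in>cuts t c. (K ^ 4 + 1) ^ r)"
    by (simp only: paths.simps) (intro sum_mono Suc.IH)
  also have "\<dots> = card (cuts t c) * (K ^ 4 + 1) ^ r" by simp
  also have "\<dots> \<le> (K ^ 4 + 1) * (K ^ 4 + 1) ^ r" by (intro mult_le_mono1 card_cuts)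
  finally show ?case by simp
qed simp

text \<open>One round of the case split in \<open>paths_rec\<close>: where \<open>P\<close> holds,
  the count is cut off with the crude bound \<open>B\<close>; elsewhere one more cut is unrolled and
  recorded in the index set.\<close>

lemma sum_paths_step:
  assumes T: "finite T" and B: "\<And>c. paths (Suc r) t c \<le> B"
  shows "(\<Sum>x\<in>T. paths (Suc r) t (h x)) \<le> card {x \<in> T. P x} * B +
    (\<Sum>q\<in>Sigma {x \<in> T. \<not> P x} (\<lambda>x. cuts t (h x)). paths r (Suc t) (snd q))"
proof -
  have "(\<Sum>x\<in>T. paths (Suc r) t (h x)) =
      (\<Sum>x\<in>{x \<in> T. P x}. paths (Suc r) t (h x)) + (\<Sum>x\<in>{x \<in> T. \<not> P x}. paths (Suc r) t (h x))"
  proof -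
    have "T = {x \<in> T. P x} \<union> {x \<in> T. \<not> P x}" by blast
    moreover have "{x \<in> T. P x} \<inter> {x \<in> T. \<not> P x} = {}" by blast
    ultimately show ?thesis
      using T sum.union_disjoint[of "{x \<in> T. P x}" "{x \<in> T. \<not> P x}" "\<lambda>x. paths (Suc r) t (h x)"] by simp
  qed
  also have "(\<Sum>x\<in>{x \<in> T. P x}. paths (Suc r) t (h x)) \<le> card {x \<in> T. P x} * B"
    using sum_bounded_above[of "{x \<in> T. P x}" "\<lambda>x. paths (Suc r) t (h x)" B] B by simp
  also have "(\<Sum>x\<in>{x \<in> T. \<not> P x}. paths (Suc r) t (h x)) =
      (\<Sum>q\<in>Sigma {x \<in> T. \<not> P x} (\<lambda>x. cuts t (h x)). paths r (Suc t) (snd q))"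
    using T by (simp add: sum.Sigma case_prod_beta)
  finally show ?thesis by simp
qed

text \<open>With \<open>e\<close> the end of the run in which the first cut must lie, split according to the first of
  the next blocks whose cut can pass \<open>e\<close>.\<close>
lemma paths_rec:
  assumes c: "c \<le> m"
    and B: "\<And>t c. paths (r + 3) t c \<le> B3" "\<And>t c. paths (r + 2) t c \<le> B2"
      "\<And>t c. paths (r + 1) t c \<le> B1" "\<And>t c. paths r t c \<le> B0"
  shows "paths (r + 4) t c \<le> 2 * K * B3 + 8 * K\<^sup>2 * B2 + 16 * K ^ 3 * B1 + 6921 * K ^ 4 * B0"
proof -
  define e where "e = Max (cuts t c)"
  have "e \<in> cuts t c" unfolding e_def using c by (intro Max_in) (auto simp: cuts_def)
  then have e: "c \<le> e" "e \<le> m" "run \<kappa> t c e" by (auto simp: cuts_def)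
  have le_e: "x \<le> e" if "x \<in> cuts t c" for x unfolding e_def using that by simp
  let ?T1 = "cuts t c"
  let ?P1 = "\<lambda>x. run \<kappa> (t + 1) x e"
  let ?T2 = "Sigma {x \<in> ?T1. \<not> ?P1 x} (\<lambda>x. cuts (t + 1) x)"
  let ?P2 = "\<lambda>q. run \<kappa> (t + 2) (snd q) e"
  let ?T3 = "Sigma {q \<in> ?T2. \<not> ?P2 q} (\<lambda>q. cuts (t + 2) (snd q))"
  let ?P3 = "\<lambda>q. run \<kappa> (t + 3) (snd q) e"
  let ?T4 = "Sigma {q \<in> ?T3. \<not> ?P3 q} (\<lambda>q. cuts (t + 3) (snd q))"
  have fin: "finite ?T1" "finite ?T2" "finite ?T3" "finite ?T4"
    by (intro finite_SigmaI finite_cuts finite_Collect_conjI disjI1 | simp)+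
  \<comment> \<open>A block that cannot run from \<open>x\<close> to \<open>e\<close> cannot run
    past \<open>e\<close> either, so its cut stays within the first run and the next block can be
    examined there.\<close>
  have stay: "y \<le> e" if "y \<in> cuts s x" "\<not> run \<kappa> s x e" for x y s
    using that run_sub[of \<kappa> s x y x e] by (force simp: cuts_def)
  have T2: "c \<le> x \<and> x \<le> y \<and> y \<le> e \<and> run \<kappa> (t + 1) x y" if "(x, y) \<in> ?T2" for x y
    using that stay by (auto simp: cuts_def)
  have T3: "(x, y) \<in> ?T2 \<and> y \<le> u \<and> u \<le> e \<and> run \<kappa> (t + 2) y u" if "((x, y), u) \<in> ?T3" for x y u
    using that stay by (auto simp: cuts_def)
  have T4: "((x, y), u) \<in> ?T3 \<and> u \<le> v \<and> v \<le> e \<and> run \<kappa> (t + 3) u v" if "(((x, y), u), v) \<in> ?T4" for x y u v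
    using that stay by (auto simp: cuts_def)
  have c1: "card {x \<in> ?T1. ?P1 x} \<le> 2 * K"
  proof -
    have "{x \<in> ?T1. ?P1 x} \<subseteq> {e - K..e}"
    proof
      fix x assume x: "x \<in> {x \<in> ?T1. ?P1 x}"
      then have "run \<kappa> t x e" by (intro run_sub[OF e(3)]) (auto simp: cuts_def)
      then have "e \<le> x + K" using x adjacent[of t x e 1] le_e[of x] e by simp
      then show "x \<in> {e - K..e}" using x le_e[of x] by auto
    qed
    then have "card {x \<in> ?T1. ?P1 x} \<le> card {e - K..e}" by (intro card_mono) auto
    also have "\<dots> \<le> 2 * K" using K by simp
    finally show ?thesis .
  qed
  have c2: "card {q \<in> ?T2. ?P2 q} \<le> 8 * K\<^sup>2"
  proof (rule le_trans[OF card_mono card_two_runs[OF e]])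
    show "finite {(x, y). c \<le> x \<and> x \<le> y \<and> y \<le> e \<and> run \<kappa> (t + 1) x y \<and> run \<kappa> (t + 2) y e}"
      by (rule finite_subset[of _ "{..e} \<times> {..e}"]) auto
    show "{q \<in> ?T2. ?P2 q} \<subseteq> {(x, y). c \<le> x \<and> x \<le> y \<and> y \<le> e \<and> run \<kappa> (t + 1) x y \<and> run \<kappa> (t + 2) y e}"
    proof
      fix q assume q: "q \<in> {q \<in> ?T2. ?P2 q}"
      obtain x y where xy: "q = (x, y)" by (metis surj_pair)
      show "q \<in> {(x, y). c \<le> x \<and> x \<le> y \<and> y \<le> e \<and> run \<kappa> (t + 1) x y \<and> run \<kappa> (t + 2) y e}"
        using q T2[of x y] unfolding xy by simp
    qed
  qed
  have c3: "card {q \<in> ?T3. ?P3 q} \<le> 16 * K ^ 3"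
  proof (rule le_trans[OF card_mono card_three_runs[OF e]])
    show "finite {((x, y), u). c \<le> x \<and> x \<le> y \<and> y \<le> u \<and> u \<le> e \<and> run \<kappa> (t + 1) x y \<and> run \<kappa> (t + 2) y u \<and> run \<kappa> (t + 3) u e}"
      by (rule finite_subset[of _ "({..e} \<times> {..e}) \<times> {..e}"]) auto
    show "{q \<in> ?T3. ?P3 q} \<subseteq> {((x, y), u). c \<le> x \<and> x \<le> y \<and> y \<le> u \<and> u \<le> e \<and> run \<kappa> (t + 1) x y \<and> run \<kappa> (t + 2) y u \<and> run \<kappa> (t + 3) u e}"
    proof
      fix q assume q: "q \<in> {q \<in> ?T3. ?P3 q}"
      obtain x y u where xyu: "q = ((x, y), u)" by (metis surj_pair)
      show "q \<in> {((x, y), u). c \<le> x \<and> x \<le> y \<and> y \<le> u \<and> u \<le> e \<and> run \<kappa> (t + 1) x y \<and> run \<kappa> (t + 2) y u \<and> run \<kappa> (t + 3) u e}"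
        using q T3[of x y u] T2[of x y] unfolding xyu by simp
    qed
  qed
  have c4: "card ?T4 \<le> 6921 * K ^ 4"
  proof (rule le_trans[OF card_mono card_four_runs[OF e]])
    show "finite {(((x, y), u), v). c \<le> x \<and> x \<le> y \<and> y \<le> u \<and> u \<le> v \<and> v \<le> e \<and>
     run \<kappa> (t + 1) x y \<and> run \<kappa> (t + 2) y u \<and> run \<kappa> (t + 3) u v}"
      by (rule finite_subset[of _ "(({..e} \<times> {..e}) \<times> {..e}) \<times> {..e}"]) auto
    show "?T4 \<subseteq> {(((x, y), u), v). c \<le> x \<and> x \<le> y \<and> y \<le> u \<and> u \<le> v \<and> v \<le> e \<and>
     run \<kappa> (t + 1) x y \<and> run \<kappa> (t + 2) y u \<and> run \<kappa> (t + 3) u v}"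
    proof
      fix q assume q: "q \<in> ?T4"
      obtain x y u v where xyuv: "q = (((x, y), u), v)" by (metis surj_pair)
      show "q \<in> {(((x, y), u), v). c \<le> x \<and> x \<le> y \<and> y \<le> u \<and> u \<le> v \<and> v \<le> e \<and>
     run \<kappa> (t + 1) x y \<and> run \<kappa> (t + 2) y u \<and> run \<kappa> (t + 3) u v}"
        using T4[of x y u v] q T3[of x y u] T2[of x y] unfolding xyuv by simp
    qed
  qed
  have "paths (r + 4) t c = (\<Sum>x\<in>?T1. paths (Suc (r + 2)) (Suc t) x)"
    by (simp add: eval_nat_numeral)
  also have "\<dots> \<le> card {x \<in> ?T1. ?P1 x} * B3 + (\<Sum>q\<in>?T2. paths (r + 2) (t + 2) (snd q))"
    using sum_paths_step[OF fin(1), of "r + 2" "Suc t" B3 "\<lambda>x. x" ?P1] B(1) by (simp add: eval_nat_numeral)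
  also have "(\<Sum>q\<in>?T2. paths (r + 2) (t + 2) (snd q)) \<le>
      card {q \<in> ?T2. ?P2 q} * B2 + (\<Sum>q\<in>?T3. paths (r + 1) (t + 3) (snd q))"
    using sum_paths_step[OF fin(2), of "r + 1" "t + 2" B2 snd ?P2] B(2) by (simp add: eval_nat_numeral)
  also have "(\<Sum>q\<in>?T3. paths (r + 1) (t + 3) (snd q)) \<le>
      card {q \<in> ?T3. ?P3 q} * B1 + (\<Sum>q\<in>?T4. paths r (t + 4) (snd q))"
    using sum_paths_step[OF fin(3), of r "t + 3" B1 snd ?P3] B(3) by (simp add: eval_nat_numeral)
  also have "(\<Sum>q\<in>?T4. paths r (t + 4) (snd q)) \<le> card ?T4 * B0"
    using sum_bounded_above[of ?T4 "\<lambda>q. paths r (t + 4) (snd q)" B0] B(4) by simp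
  finally have "paths (r + 4) t c \<le> card {x \<in> ?T1. ?P1 x} * B3 + (card {q \<in> ?T2. ?P2 q} * B2 +
      (card {q \<in> ?T3. ?P3 q} * B1 + card ?T4 * B0))" by simp
  also have "\<dots> \<le> 2 * K * B3 + (8 * K\<^sup>2 * B2 + (16 * K ^ 3 * B1 + 6921 * K ^ 4 * B0))"
    by (intro add_mono mult_le_mono1 c1 c2 c3 c4)
  finally show ?thesis by (simp add: add.assoc)
qed

lemma paths_beyond: "m < c \<Longrightarrow> paths r t c = 0"
  by (cases r) (auto simp: cuts_def)

text \<open>With growth rate \<open>16 * K\<close> the recursion closes because
  \<open>2 * 16 ^ 3 + 8 * 16 ^ 2 + 16 * 16 + 6921 \<le> 16 ^ 4\<close>; the prefactor takes care of
  \<open>r < 4\<close>.\<close>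

lemma paths_bound: "paths r t c \<le> (K ^ 4 + 1) ^ 3 * (16 * K) ^ r"
proof (induction r arbitrary: t c rule: less_induct)
  case (less r)
  let ?b = "(K ^ 4 + 1) ^ 3" and ?l = "16 * K"
  show ?case
  proof (cases "r < 4")
    case True
    have "paths r t c \<le> (K ^ 4 + 1) ^ r" by (rule paths_trivial)
    also have "\<dots> \<le> (K ^ 4 + 1) ^ 3" using True by (intro power_increasing) auto
    also have "\<dots> \<le> ?b * ?l ^ r" using mult_le_mono2[of 1 "?l ^ r" ?b] one_le_power[of ?l r] K by simp
    finally show ?thesis .
  next
    case False
    show ?thesis
    proof (cases "c \<le> m")
      case True
      define s where "s = r - 4"
      have r: "r = s + 4" using False by (simp add: s_def)
      have "paths (s + 4) t c \<le> 2 * K * (?b * ?l ^ (s + 3)) + 8 * K\<^sup>2 * (?b * ?l ^ (s + 2)) +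
          16 * K ^ 3 * (?b * ?l ^ (s + 1)) + 6921 * K ^ 4 * (?b * ?l ^ s)"
        by (rule paths_rec[OF True]) (rule less.IH, simp add: r)+
      also have "\<dots> \<le> ?b * ?l ^ (s + 4)"
      proof -
        have "2 * K * (b * (16 * K) ^ (s + 3)) + 8 * K\<^sup>2 * (b * (16 * K) ^ (s + 2)) +
            16 * K ^ 3 * (b * (16 * K) ^ (s + 1)) + 6921 * K ^ 4 * (b * (16 * K) ^ s) \<le> b * (16 * K) ^ (s + 4)" for b
        proof -
          define X where "X = b * (16 * K) ^ s * K ^ 4"
          have e: "2 * K * (b * (16 * K) ^ (s + 3)) = 8192 * X" "8 * K\<^sup>2 * (b * (16 * K) ^ (s + 2)) = 2048 * X"
            "16 * K ^ 3 * (b * (16 * K) ^ (s + 1)) = 256 * X" "6921 * K ^ 4 * (b * (16 * K) ^ s) = 6921 * X"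
            "b * (16 * K) ^ (s + 4) = 65536 * X"
            by (simp_all add: X_def power_add power_mult_distrib power2_eq_square power3_eq_cube power4_eq_xxxx)
          show ?thesis unfolding e by simp
        qed
        then show ?thesis .
      qed
      finally show ?thesis by (simp add: r)
    qed (simp add: paths_beyond)
  qed
qed

end

section \<open>Bit orders\<close>

text \<open>Blocks come in four kinds, according to \<open>t mod 4\<close>. At each bit position two of the four kinds
  reverse the order of the bit. Consecutive kinds treat one position in four alike, kinds at distance
  two treat half of the positions alike.\<close>
definition flip :: "nat \<Rightarrow> nat \<Rightarrow> bool" where
  "flip t q \<longleftrightarrow> (if q mod 4 < 2 then odd t else if q mod 4 = 2 then t mod 4 \<in> {1, 2} else t mod 4 \<in> {2, 3})"

text \<open>The lowest \<open>j\<close> bits of \<open>x\<close>, complemented at the flipped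
  positions. The recursion strips the lowest bit, and \<open>p\<close> is the index of that bit in
  the pattern \<open>flip\<close>.\<close>

primrec bit_key :: "nat \<Rightarrow> nat \<Rightarrow> nat \<Rightarrow> nat \<Rightarrow> nat" where
  "bit_key 0 t p x = 0"
| "bit_key (Suc j) t p x = 2 * bit_key j t (Suc p) (x div 2) + (if flip t p then 1 - x mod 2 else x mod 2)"

lemma bit_key_less: "bit_key j t p x < 2 ^ j"
proof (induction j arbitrary: p x)
  case (Suc j)
  have "bit_key j t (Suc p) (x div 2) + 1 \<le> 2 ^ j" using Suc by (simp add: Suc_le_eq)
  moreover have "(if flip t p then 1 - x mod 2 else x mod 2) \<le> 1" by auto
  ultimately show ?case unfolding bit_key.simps power_Suc by linarith
qed simp

lemma bit_key_div2: "bit_key (Suc j) t p x div 2 = bit_key j t (Suc p) (x div 2)"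
  by auto

lemma bit_key_inject: "x < 2 ^ j \<Longrightarrow> y < 2 ^ j \<Longrightarrow> bit_key j t p x = bit_key j t p y \<longleftrightarrow> x = y"
proof (induction j arbitrary: p x y)
  case (Suc j)
  have "x = y" if e: "bit_key (Suc j) t p x = bit_key (Suc j) t p y"
  proof -
    have "bit_key j t (Suc p) (x div 2) = bit_key j t (Suc p) (y div 2)"
      using e bit_key_div2 by metis
    moreover have "x div 2 < 2 ^ j" "y div 2 < 2 ^ j" using Suc.prems by auto
    ultimately have d: "x div 2 = y div 2" using Suc.IH by blast
    then have "(if flip t p then 1 - x mod 2 else x mod 2) = (if flip t p then 1 - y mod 2 else y mod 2)"
      using e by simp
    moreover have "x mod 2 \<le> 1" "y mod 2 \<le> 1" by simp_all
    ultimately have "x mod 2 = y mod 2" by (simp split: if_splits)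
    then show "x = y" using d by (metis mult_div_mod_eq)
  qed
  then show ?case by blast
qed simp

text \<open>The order of two letters is decided by the highest bit in which they differ.\<close>
lemma bit_key_decided:
  "x < 2 ^ j \<Longrightarrow> y < 2 ^ j \<Longrightarrow> x \<noteq> y \<Longrightarrow> \<exists>q b. \<forall>t. bit_key j t p x < bit_key j t p y \<longleftrightarrow> flip t q = b"
proof (induction j arbitrary: p x y)
  case (Suc j)
  have d: "x div 2 < 2 ^ j" "y div 2 < 2 ^ j" using Suc.prems by auto
  show ?case
  proof (cases "x div 2 = y div 2")
    case True
    then have "x mod 2 \<noteq> y mod 2" using Suc.prems(3) by (metis mult_div_mod_eq)
    then have "x mod 2 = 0 \<and> y mod 2 = 1 \<or> x mod 2 = 1 \<and> y mod 2 = 0" by auto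
    then have "\<forall>t. bit_key (Suc j) t p x < bit_key (Suc j) t p y \<longleftrightarrow> flip t p = (x mod 2 = 1)"
      using True by auto
    then show ?thesis by blast
  next
    case False
    obtain q b where qb: "\<forall>t. bit_key j t (Suc p) (x div 2) < bit_key j t (Suc p) (y div 2) \<longleftrightarrow> flip t q = b"
      using Suc.IH[OF d False] by blast
    have "bit_key (Suc j) t p x < bit_key (Suc j) t p y \<longleftrightarrow>
        bit_key j t (Suc p) (x div 2) < bit_key j t (Suc p) (y div 2)" for t
    proof -
      have ne: "bit_key j t (Suc p) (x div 2) \<noteq> bit_key j t (Suc p) (y div 2)"
        using False bit_key_inject[OF d] by blast
      have lt: "2 * a + r < 2 * a' + r' \<longleftrightarrow> a < a'" if "a \<noteq> a'" "r \<le> 1" "r' \<le> 1" for a a' r r' :: nat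
        using that by linarith
      show ?thesis unfolding bit_key.simps by (rule lt[OF ne]) auto
    qed
    then show ?thesis using qb by blast
  qed
qed simp

text \<open>At every position two of the four kinds flip and two do not, so no three different kinds
  coincide there.\<close>

lemma flip_three:
  assumes "0 < d" "d < d'" "d' < 4" "flip t q = b" "flip (t + d) q = b"
  shows "flip (t + d') q \<noteq> b"
proof -
  have "d = 1 \<and> d' = 2 \<or> d = 1 \<and> d' = 3 \<or> d = 2 \<and> d' = 3" using assms by linarith
  moreover have "\<exists>r. t = 4 * r \<or> t = 4 * r + 1 \<or> t = 4 * r + 2 \<or> t = 4 * r + 3" by presburger
  then obtain r where "t = 4 * r \<or> t = 4 * r + 1 \<or> t = 4 * r + 2 \<or> t = 4 * r + 3" by blast
  ultimately show ?thesis using assms(4,5)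
    by (elim disjE conjE; simp add: flip_def mod_Suc split: if_splits)
qed

section \<open>Common chains of two bit orders\<close>

definition agreements :: "nat \<Rightarrow> nat \<Rightarrow> nat \<Rightarrow> nat \<Rightarrow> nat" where
  "agreements t t' p i = (\<Sum>q<i. of_bool (flip t (p + q) = flip t' (p + q)))"

lemma agreements_Suc: "agreements t t' p (Suc i) = of_bool (flip t p = flip t' p) + agreements t t' (Suc p) i"
  unfolding agreements_def sum.lessThan_Suc_shift by simp

text \<open>In each group of four positions, kinds at distance two agree exactly at the first two,
  and cyclically consecutive kinds at exactly one of the last two.\<close>

lemma agreements_4:
  assumes "0 < d" "d < 4"
  shows "agreements t (t + d) 0 (4 * a) = (if d = 2 then 2 else 1) * a"
proof (induction a)
  case (Suc a)
  have f: "flip s (4 * a + r) = flip s r" for s r by (simp add: flip_def)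
  have "\<exists>r. t = 4 * r \<or> t = 4 * r + 1 \<or> t = 4 * r + 2 \<or> t = 4 * r + 3" by presburger
  then obtain r where r: "t = 4 * r \<or> t = 4 * r + 1 \<or> t = 4 * r + 2 \<or> t = 4 * r + 3" by blast
  have d: "d = 1 \<or> d = 2 \<or> d = 3" using assms by linarith
  have "agreements t (t + d) 0 (4 * Suc a) = agreements t (t + d) 0 (4 * a) +
      (of_bool (flip t 0 = flip (t + d) 0) + of_bool (flip t 1 = flip (t + d) 1)
       + of_bool (flip t 2 = flip (t + d) 2) + of_bool (flip t 3 = flip (t + d) 3))"
    using f[of _ 0] f[of _ 1] f[of _ 2] f[of _ 3]
    by (simp add: agreements_def eval_nat_numeral)
  also have "of_bool (flip t 0 = flip (t + d) 0) + of_bool (flip t 1 = flip (t + d) 1)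
       + of_bool (flip t 2 = flip (t + d) 2) + of_bool (flip t 3 = flip (t + d) 3) = (if d = 2 then 2 else 1 :: nat)"
    using r d by (elim disjE; simp add: flip_def mod_Suc)
  finally show ?case using Suc.IH by simp
qed (simp add: agreements_def)

text \<open>Induction removing the lowest bit: siblings, which differ in that bit alone, can both be
  in \<open>X\<close> only if the two kinds treat it alike. Only the lowest \<open>i\<close> bits
  contribute, as the higher part of the key is fixed.\<close>

lemma card_agree_block:
  assumes "finite X" "X \<subseteq> {..<2 ^ j}" "i \<le> j"
    and "\<And>x y. x \<in> X \<Longrightarrow> y \<in> X \<Longrightarrow> bit_key j t p x < bit_key j t p y \<Longrightarrow> bit_key j t' p x < bit_key j t' p y"
    and "\<And>x y. x \<in> X \<Longrightarrow> y \<in> X \<Longrightarrow> bit_key j t p x div 2 ^ i = bit_key j t p y div 2 ^ i"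
  shows "card X \<le> 2 ^ agreements t t' p i"
  using assms
proof (induction i arbitrary: j p X)
  case 0
  have "y \<le> x + 0" if "x \<in> X" "y \<in> X" for x y
    using that 0(2) 0(5)[OF that] bit_key_inject[of x j y t p] by auto
  then have "card X \<le> 0 + 1" by (rule card_le_diameter(2))
  then show ?case by (simp add: agreements_def)
next
  case (Suc i)
  obtain j' where j: "j = Suc j'" using Suc.prems(3) by (cases j) auto
  have lt: "2 * a + r < 2 * a' + r' \<longleftrightarrow> a < a'" if "a \<noteq> a'" "r \<le> 1" "r' \<le> 1" for a a' r r' :: nat
    using that by linarith
  have rem: "(if flip s p then 1 - x mod 2 else x mod 2) \<le> (1::nat)" for s x by auto
  have X2: "x div 2 < 2 ^ j'" if "x \<in> X" for x using that Suc.prems(2) j by auto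
  have key_iff: "bit_key j s p x < bit_key j s p y \<longleftrightarrow> bit_key j' s (Suc p) (x div 2) < bit_key j' s (Suc p) (y div 2)"
    if "x \<in> X" "y \<in> X" "x div 2 \<noteq> y div 2" for s x y
    unfolding j bit_key.simps using bit_key_inject[of "x div 2" j' "y div 2" s "Suc p"] X2 that
    by (intro lt rem) auto
  have IH: "card ((\<lambda>x. x div 2) ` X) \<le> 2 ^ agreements t t' (Suc p) i"
  proof (rule Suc.IH[of _ j'])
    show "finite ((\<lambda>x. x div 2) ` X)" using Suc.prems by simp
    show "(\<lambda>x. x div 2) ` X \<subseteq> {..<2 ^ j'}" using X2 by auto
    show "i \<le> j'" using Suc.prems j by simp
  next
    fix u v assume u: "u \<in> (\<lambda>x. x div 2) ` X" and v: "v \<in> (\<lambda>x. x div 2) ` X"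
    obtain x y where x: "x \<in> X" "u = x div 2" and y: "y \<in> X" "v = y div 2" using u v by blast
    { assume l: "bit_key j' t (Suc p) u < bit_key j' t (Suc p) v"
      then have ne: "x div 2 \<noteq> y div 2" using x y by auto
      then show "bit_key j' t' (Suc p) u < bit_key j' t' (Suc p) v"
        using l key_iff[OF x(1) y(1) ne] Suc.prems(4)[OF x(1) y(1)] x y by simp }
    have "bit_key j t p x div 2 ^ Suc i = bit_key j t p y div 2 ^ Suc i" using Suc.prems(5) x y by blast
    then show "bit_key j' t (Suc p) u div 2 ^ i = bit_key j' t (Suc p) v div 2 ^ i"
      unfolding power_Suc div_mult2_eq j bit_key_div2 x(2) y(2) .
  qed
  have fib: "card {x \<in> X. x div 2 = y} \<le> 2 ^ of_bool (flip t p = flip t' p)" for y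
  proof -
    have sub: "{x \<in> X. x div 2 = y} \<subseteq> {2 * y, 2 * y + 1}" by auto
    show ?thesis
    proof (cases "flip t p = flip t' p")
      case True
      have "card {x \<in> X. x div 2 = y} \<le> card {2 * y, 2 * y + 1}" using sub by (intro card_mono) auto
      then show ?thesis using True by simp
    next
      case False
      have "\<not> {2 * y, 2 * y + 1} \<subseteq> X"
      proof
        assume "{2 * y, 2 * y + 1} \<subseteq> X"
        then have "bit_key j t p (2 * y) < bit_key j t p (2 * y + 1) \<Longrightarrow> bit_key j t' p (2 * y) < bit_key j t' p (2 * y + 1)"
          "bit_key j t p (2 * y + 1) < bit_key j t p (2 * y) \<Longrightarrow> bit_key j t' p (2 * y + 1) < bit_key j t' p (2 * y)"
          using Suc.prems(4) by auto
        then show False using False unfolding j by (auto split: if_splits)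
      qed
      then have "{x \<in> X. x div 2 = y} \<subseteq> {2 * y} \<or> {x \<in> X. x div 2 = y} \<subseteq> {2 * y + 1}" using sub by auto
      then have "card {x \<in> X. x div 2 = y} \<le> 1"
        using card_mono[of "{2 * y}"] card_mono[of "{2 * y + 1}"] by fastforce
      then show ?thesis using False by simp
    qed
  qed
  have "card X \<le> card ((\<lambda>x. x div 2) ` X) * 2 ^ of_bool (flip t p = flip t' p)"
    using card_le_fibres[of X "\<lambda>x. x div 2" "real (2 ^ of_bool (flip t p = flip t' p))"] fib Suc.prems(1)
    by (simp only: of_nat_le_iff flip: of_nat_mult)
  also have "\<dots> \<le> 2 ^ agreements t t' (Suc p) i * 2 ^ of_bool (flip t p = flip t' p)"
    by (intro mult_le_mono1 IH)
  also have "\<dots> = 2 ^ agreements t t' p (Suc i)" by (simp add: agreements_Suc power_add)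
  finally show ?case .
qed

section \<open>The periodic word\<close>

text \<open>With \<open>4 * D\<close> bits the flip pattern goes through \<open>D\<close> full
  periods, and the keys lie below \<open>16 ^ D = (2 ^ D) ^ 4\<close>, which suits
  \<open>K = 2 ^ D\<close>.\<close>

definition letter_key :: "nat \<Rightarrow> nat \<Rightarrow> nat \<Rightarrow> nat" where
  "letter_key D t x = bit_key (4 * D) t 0 x"

lemma run_decided:
  assumes r: "run (\<lambda>t i. letter_key D t (v ! i)) t x y" and ij: "x \<le> i" "i < j" "j < y"
  shows "letter_key D t (v ! i) < letter_key D t (v ! j)"
  using assms by (simp add: run_def)

text \<open>Along a common run the letters are distinct and their keys of both kinds grow together,
  so \<open>card_agree_block\<close> applies to the letters of one aligned block of keys.\<close>

lemma card_run_block: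
  assumes v: "set v \<subseteq> {..<2 ^ (4 * D)}" and y: "y \<le> length v" and d: "0 < d" "d < 4" and a: "a \<le> D"
    and r: "run (\<lambda>t i. letter_key D t (v ! i)) t x y" "run (\<lambda>t i. letter_key D t (v ! i)) (t + d) x y"
  shows "card {i \<in> {x..<y}. letter_key D t (v ! i) div 16 ^ a = b} \<le> 2 ^ ((if d = 2 then 2 else 1) * a)"
proof -
  let ?I = "{i \<in> {x..<y}. letter_key D t (v ! i) div 16 ^ a = b}"
  have inj: "inj_on (\<lambda>i. v ! i) ?I"
  proof (rule inj_onI, rule ccontr)
    fix i j assume "i \<in> ?I" "j \<in> ?I" "v ! i = v ! j" "i \<noteq> j"
    then show False using run_decided[OF r(1), of i j] run_decided[OF r(1), of j i] by (cases "i < j") auto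
  qed
  have "card ((\<lambda>i. v ! i) ` ?I) \<le> 2 ^ agreements t (t + d) 0 (4 * a)"
  proof (rule card_agree_block)
    show "finite ((\<lambda>i. v ! i) ` ?I)" by simp
    show "(\<lambda>i. v ! i) ` ?I \<subseteq> {..<2 ^ (4 * D)}" using v y by (force simp: subset_iff)
    show "4 * a \<le> 4 * D" using a by simp
  next
    fix u u' assume "u \<in> (\<lambda>i. v ! i) ` ?I" "u' \<in> (\<lambda>i. v ! i) ` ?I"
    then obtain i j where i: "i \<in> ?I" "u = v ! i" and j: "j \<in> ?I" "u' = v ! j" by blast
    have "(2::nat) ^ (4 * a) = 16 ^ a" by (simp add: power_mult)
    then show "bit_key (4 * D) t 0 u div 2 ^ (4 * a) = bit_key (4 * D) t 0 u' div 2 ^ (4 * a)"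
      using i j by (simp add: letter_key_def)
    assume l: "bit_key (4 * D) t 0 u < bit_key (4 * D) t 0 u'"
    then have "i < j"
      using i j run_decided[OF r(1), of j i] by (cases i j rule: linorder_cases) (auto simp: letter_key_def)
    then show "bit_key (4 * D) (t + d) 0 u < bit_key (4 * D) (t + d) 0 u'"
      using i j run_decided[OF r(2), of i j] by (simp add: letter_key_def)
  qed
  then show ?thesis unfolding card_image[OF inj] agreements_4[OF d] .
qed

text \<open>An interval of \<open>L\<close> keys meets at most two aligned blocks of size \<open>16 ^ a\<close>, where
  \<open>L \<le> 16 ^ a < 16 * L\<close>, and in each block a common run has at most \<open>4 ^ a\<close> letters.\<close>
lemma run_system_letter_key:
  assumes v: "set v \<subseteq> {..<2 ^ (4 * D)}"
  shows "run_system (\<lambda>t i. letter_key D t (v ! i)) (length v) (2 ^ D)"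
proof
  let ?k = "\<lambda>t i. letter_key D t (v ! i)"
  have less: "?k t i < 16 ^ D" for t i
    using bit_key_less[of "4 * D" t 0 "v ! i"] by (simp add: letter_key_def power_mult)
  have pw: "(2 ^ D) ^ 4 = (16 ^ D :: nat)" by (simp add: power_mult[symmetric] mult.commute[of D] power_mult)
  \<comment> \<open>All keys lie in a single block of size \<open>16 ^ D\<close>, so the block bound
    with \<open>a = D\<close> limits whole runs.\<close>
  have total: "y - x \<le> 2 ^ ((if d = 2 then 2 else 1) * D)"
    if "run ?k t x y" "run ?k (t + d) x y" "0 < d" "d < 4" "y \<le> length v" for t d x y
  proof -
    have "{i \<in> {x..<y}. letter_key D t (v ! i) div 16 ^ D = 0} = {x..<y}" using less by auto
    then have "card {x..<y} \<le> 2 ^ ((if d = 2 then 2 else 1) * D)"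
      using card_run_block[OF v that(5,3,4) le_refl that(1,2), of 0] by simp
    then show ?thesis by simp
  qed
  show "(1::nat) \<le> 2 ^ D" by simp
  show "?k t i < (2 ^ D) ^ 4" for t i using less pw by simp
  show "y \<le> x + 2 ^ D"
    if "run ?k t x y" "run ?k (t + d) x y" "d = 1 \<or> d = 3" "x \<le> y" "y \<le> length v" for t x y d
    using total[OF that(1,2)] that(3-5) by auto
  show "y \<le> x + (2 ^ D)\<^sup>2"
    if "run ?k t x y" "run ?k (t + 2) x y" "x \<le> y" "y \<le> length v" for t x y
    using total[OF that(1,2)] that(3,4) by (simp add: power_mult[symmetric] mult.commute)
  show "y \<le> x + 1"
    if r: "run ?k t x y" "run ?k (t + d) x y" "run ?k (t + d') x y" and d: "0 < d" "d < d'" "d' < 4"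
      and xy: "x \<le> y" "y \<le> length v" for t x y d d'
  \<comment> \<open>Two consecutive letters of the run would be ordered alike by three kinds, but a
    single bit decides their order in all kinds.\<close>
  proof (rule ccontr)
    assume "\<not> y \<le> x + 1"
    then have l: "?k s x < ?k s (Suc x)" if "s \<in> {t, t + d, t + d'}" for s
      using run_decided[of D v s x y x "Suc x"] r that by auto
    have "Suc x < length v" using \<open>\<not> y \<le> x + 1\<close> xy by simp
    then have "v ! x < 2 ^ (4 * D)" "v ! Suc x < 2 ^ (4 * D)" using v by (auto simp: subset_iff)
    moreover have "v ! x \<noteq> v ! Suc x" using l[of t] by auto
    ultimately obtain q b where "\<And>s. ?k s x < ?k s (Suc x) \<longleftrightarrow> flip s q = b"
      using bit_key_decided[of "v ! x" "4 * D" "v ! Suc x" 0] unfolding letter_key_def by metis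
    then show False using l flip_three[OF d, of t q b] by blast
  qed
  show "(y - x)\<^sup>2 + 64 * ?k t x \<le> 64 * (?k t (y - 1) + 1)"
    if r: "run ?k t x y" "run ?k (t + d) x y" and d: "0 < d" "d < 4" and xy: "x < y" "y \<le> length v" for t x y d
  proof -
    have kle: "?k t x \<le> ?k t i \<and> ?k t i \<le> ?k t (y - 1)" if "x \<le> i" "i < y" for i
      using run_decided[OF r(1), of x i] run_decided[OF r(1), of i "y - 1"] that
      by (cases "x = i"; cases "i = y - 1") (auto simp: less_imp_le)
    define L where "L = ?k t (y - 1) + 1 - ?k t x"
    have L: "1 \<le> L" "?k t (y - 1) + 1 = ?k t x + L" using kle[of x] xy by (auto simp: L_def)
    define a where "a = (LEAST a. L \<le> 16 ^ a)"
    have LD: "L \<le> 16 ^ D" using less[of t "y - 1"] by (simp add: L_def)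
    then have a: "L \<le> 16 ^ a" "a \<le> D" unfolding a_def by (auto intro: LeastI Least_le)
    have up: "16 ^ a \<le> 16 * L"
    proof (cases a)
      case (Suc c)
      then have "\<not> L \<le> 16 ^ c" using not_less_Least[of c "\<lambda>a. L \<le> 16 ^ a"] by (auto simp: a_def)
      then show ?thesis using Suc by simp
    qed (use L in simp)
    define c where "c = ?k t x div 16 ^ a"
    let ?I = "\<lambda>b. {i \<in> {x..<y}. ?k t i div 16 ^ a = b}"
    have "{x..<y} \<subseteq> ?I c \<union> ?I (Suc c)"
    proof
      fix i assume i: "i \<in> {x..<y}"
      have "c \<le> ?k t i div 16 ^ a" unfolding c_def using kle i by (intro div_le_mono) auto
      moreover have "?k t i div 16 ^ a \<le> Suc c"
      proof -
        have "?k t i \<le> ?k t x + 16 ^ a" using kle[of i] i L a by auto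
        then have "?k t i div 16 ^ a \<le> (?k t x + 16 ^ a) div 16 ^ a" by (rule div_le_mono)
        then show ?thesis by (simp add: c_def)
      qed
      ultimately have "?k t i div 16 ^ a = c \<or> ?k t i div 16 ^ a = Suc c" by linarith
      then show "i \<in> ?I c \<union> ?I (Suc c)" using i by blast
    qed
    then have "card {x..<y} \<le> card (?I c \<union> ?I (Suc c))" by (intro card_mono) auto
    also have "\<dots> \<le> card (?I c) + card (?I (Suc c))" by (rule card_Un_le)
    also have "\<dots> \<le> 2 ^ ((if d = 2 then 2 else 1) * a) + 2 ^ ((if d = 2 then 2 else 1) * a)"
      by (intro add_mono card_run_block[OF v xy(2) d a(2) r])
    also have "\<dots> \<le> 4 ^ a + 4 ^ a"
    proof -
      have "(2::nat) ^ ((if d = 2 then 2 else 1) * a) \<le> 2 ^ (2 * a)" by (intro power_increasing) auto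
      then show ?thesis by (simp add: power_mult)
    qed
    finally have "y - x \<le> 2 * 4 ^ a" by simp
    then have "(y - x)\<^sup>2 \<le> (2 * 4 ^ a)\<^sup>2" by (intro power_mono) auto
    \<comment> \<open>Here the constant 64 arises: two blocks of \<open>4 ^ a\<close> letters give
      the square \<open>4 * 16 ^ a\<close>, and \<open>16 ^ a \<le> 16 * L\<close>.\<close>
    also have "(2 * 4 ^ a)\<^sup>2 = 4 * (16 ^ a :: nat)"
      by (simp add: power_mult_distrib power_mult[symmetric] mult.commute[of a 2]) (simp add: power_mult)
    also have "4 * 16 ^ a \<le> 64 * L" using up by simp
    finally show ?thesis using L(2) by simp
  qed
qed

section \<open>Maps into a concatenation of blocks\<close>

lemma cnt_pos_set: "cnt u w > 0 \<Longrightarrow> set u \<subseteq> set w"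
  by (induction u w rule: cnt.induct) (auto split: if_splits)

text \<open>Strictly increasing keys make the letters of \<open>w\<close> distinct, so each letter
  of \<open>u\<close> has at most one place, and these places ascend only if the keys along
  \<open>u\<close> do.\<close>

lemma cnt_sorted:
  assumes "sorted_wrt (\<lambda>x y. f x < (f y :: nat)) w"
  shows "cnt u w \<le> of_bool (sorted_wrt (\<lambda>x y. f x < f y) u)"
  using assms
proof (induction u w rule: cnt.induct)
  case (3 a v b w)
  show ?case
  proof (cases "a = b")
    case True
    then have "a \<notin> set w" using 3(3) by auto
    then have 0: "cnt (a # v) w = 0" using cnt_pos_set[of "a # v" w] by auto
    show ?thesis
    proof (cases "cnt v w = 0")
      case False
      then have "set v \<subseteq> set w" using cnt_pos_set[of v w] by simp
      then have "\<forall>x\<in>set v. f a < f x" using 3(3) True by auto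
      then show ?thesis using 0 True 3(2)[OF True] 3(3) by simp
    qed (use 0 True in simp)
  qed (use 3 in simp)
qed simp_all

definition block :: "nat \<Rightarrow> nat \<Rightarrow> nat \<Rightarrow> nat list" where
  "block D k t = sort_key (letter_key D t) [1..<Suc k]"

lemma set_block: "set (block D k t) = {1..k}" and length_block: "length (block D k t) = k"
  by (auto simp: block_def)

lemma sorted_block:
  assumes "k < 2 ^ (4 * D)"
  shows "sorted_wrt (\<lambda>x y. letter_key D t x < letter_key D t y) (block D k t)"
proof -
  have "inj_on (letter_key D t) {1..k}"
    using assms bit_key_inject[of _ "4 * D" _ t 0] by (auto simp: inj_on_def letter_key_def)
  then have "distinct (map (letter_key D t) (block D k t))"
    by (simp add: distinct_map set_block) (simp add: block_def)
  moreover have "sorted (map (letter_key D t) (block D k t))" by (simp add: block_def)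
  ultimately have "sorted_wrt (<) (map (letter_key D t) (block D k t))"
    by (simp only: strict_sorted_iff)
  then show ?thesis by (simp add: sorted_wrt_map)
qed

text \<open>By \<open>cnt_append\<close> maps are classified by the cuts of \<open>v\<close> between
  blocks: within a block a piece fits at most once, and only if it is a run.\<close>

lemma cnt_blocks:
  assumes k: "k < 2 ^ (4 * D)" and v: "set v \<subseteq> {1..k}" and c: "c \<le> length v"
  shows "cnt (drop c v) (concat (map (block D k) [t..<t + r]))
    \<le> run_system.paths (\<lambda>t i. letter_key D t (v ! i)) (length v) r t c"
proof -
  interpret run_system "\<lambda>t i. letter_key D t (v ! i)" "length v" "2 ^ D"
    using v k by (intro run_system_letter_key) auto
  show ?thesis using c
  proof (induction r arbitrary: t c)
    case 0
    then show ?case by (cases "drop c v") auto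
  next
    case (Suc r)
    let ?rest = "concat (map (block D k) [Suc t..<Suc t + r])"
    let ?m = "length v"
    have "cnt (drop c v) (concat (map (block D k) [t..<t + Suc r])) = cnt (drop c v) (block D k t @ ?rest)"
      by (simp add: upt_conv_Cons del: upt_Suc)
    also have "\<dots> = (\<Sum>j\<le>?m - c. cnt (take j (drop c v)) (block D k t) * cnt (drop (c + j) v) ?rest)"
      unfolding cnt_append by (simp add: add.commute)
    also have "\<dots> \<le> (\<Sum>j\<le>?m - c. of_bool (c + j \<in> cuts t c) * paths r (Suc t) (c + j))"
    proof (intro sum_mono mult_le_mono)
      fix j assume "j \<in> {..?m - c}"
      then have j: "c + j \<le> ?m" using Suc.prems by auto
      then show "cnt (drop (c + j) v) ?rest \<le> paths r (Suc t) (c + j)" by (rule Suc.IH)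
      have "c + j \<in> cuts t c" if s: "sorted_wrt (\<lambda>x y. letter_key D t x < letter_key D t y) (take j (drop c v))"
        unfolding cuts_def run_def
      proof (clarsimp simp: j)
        fix i i' assume "c \<le> i" "i < i'" "i' < c + j"
        then show "letter_key D t (v ! i) < letter_key D t (v ! i')"
          using sorted_wrt_nth_less[OF s, of "i - c" "i' - c"] j by simp
      qed
      then have "of_bool (sorted_wrt (\<lambda>x y. letter_key D t x < letter_key D t y) (take j (drop c v)))
          \<le> (of_bool (c + j \<in> cuts t c) :: nat)" by auto
      then show "cnt (take j (drop c v)) (block D k t) \<le> of_bool (c + j \<in> cuts t c)"
        using cnt_sorted[OF sorted_block[OF k]] le_trans by blast
    qed
    also have "\<dots> = (\<Sum>c'\<in>{c..?m}. of_bool (c' \<in> cuts t c) * paths r (Suc t) c')"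
      by (rule sum.reindex_bij_witness[of _ "\<lambda>c'. c' - c" "\<lambda>j. c + j"]) (use Suc.prems in auto)
    also have "\<dots> = (\<Sum>c'\<in>cuts t c. paths r (Suc t) c')"
      by (rule sum.mono_neutral_cong_right) (auto simp: cuts_def)
    finally show ?case by simp
  qed
qed

lemma max_maps_blocks:
  assumes k: "k < 2 ^ (4 * D)"
  shows "max_maps k (concat (map (block D k) [0..<r])) \<le> (16 ^ D + 1) ^ 3 * (16 * 2 ^ D) ^ r"
proof -
  obtain v where v: "v \<in> words k" "cnt v (concat (map (block D k) [0..<r])) = max_maps k (concat (map (block D k) [0..<r]))"
    by (rule max_maps_attained)
  have sv: "set v \<subseteq> {1..k}" using v set_subset_words by blast
  interpret run_system "\<lambda>t i. letter_key D t (v ! i)" "length v" "2 ^ D"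
    using sv k by (intro run_system_letter_key) auto
  have "max_maps k (concat (map (block D k) [0..<r])) \<le> paths r 0 0"
    using cnt_blocks[OF k sv, of 0 0 r] v by simp
  also have "\<dots> \<le> ((2 ^ D) ^ 4 + 1) ^ 3 * (16 * 2 ^ D) ^ r" by (rule paths_bound)
  also have "((2::nat) ^ D) ^ 4 = 16 ^ D" by (simp add: power_mult[symmetric] mult.commute[of D] power_mult)
  finally show ?thesis .
qed

text \<open>The periodic word is truncated to length \<open>n\<close>; passing to a prefix does not
  increase the maximum, so the bound for \<open>n div k + 1\<close> complete blocks remains.\<close>

lemma min_max_maps_le:
  assumes k: "k \<ge> 1" "k < 2 ^ (4 * D)"
  shows "min_max_maps k n \<le> (16 ^ D + 1) ^ 3 * (16 * 2 ^ D) ^ (n div k + 1)"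
proof -
  define W where "W = concat (map (block D k) [0..<n div k + 1])"
  have "length W = k * (n div k + 1)"
    unfolding W_def length_concat map_map o_def length_block by (simp add: sum_list_triv)
  then have len: "n \<le> length W" using k dividend_less_times_div[of k n] by simp
  have "set W \<subseteq> {1..k}" by (auto simp: W_def set_block)
  then have "take n W \<in> words_of_length k n"
    using len set_take_subset[of n W] by (auto simp: words_of_length_eq)
  then have "min_max_maps k n \<le> max_maps k (take n W)"
    unfolding min_max_maps_def by (intro Min_le) (auto intro: finite_words_of_length)
  also have "\<dots> \<le> max_maps k W" using max_maps_take_mono[OF len, of k W] by simp
  also have "\<dots> \<le> (16 ^ D + 1) ^ 3 * (16 * 2 ^ D) ^ (n div k + 1)"
    unfolding W_def by (rule max_maps_blocks[OF k(2)])
  finally show ?thesis .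
qed

section \<open>Upper bound\<close>

text \<open>After raising to the power \<open>x = k / n\<close> the blocks contribute
  \<open>16 * 2 ^ D\<close> up to a constant factor, and the prefactor, polynomial in
  \<open>k\<close>, is harmless because the condition on \<open>n\<close> makes
  \<open>x * ln k\<close> at most \<open>1 / 2\<close>.\<close>

lemma min_max_maps_upper:
  assumes k: "k \<ge> 2" and nk: "real n \<ge> 2 * real k * ln (real k)"
  shows "real (min_max_maps k n) powr (real k / real n) \<le> exp 28 * real k powr (1/4)"
proof -
  \<comment> \<open>The least choice gives \<open>16 ^ D \<le> 16 * k\<close>, that is,
    \<open>2 ^ D\<close> is at most twice the fourth root of \<open>k\<close>.\<close>
  define D where "D = (LEAST D. k < 16 ^ D)"
  have "k < 16 ^ k" by (rule less_exp[THEN less_le_trans]) (simp add: power_mono)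
  then have kD: "k < 16 ^ D" unfolding D_def by (rule LeastI)
  obtain c where c: "D = Suc c" using kD k by (cases D) auto
  then have "\<not> k < 16 ^ c" using not_less_Least[of c "\<lambda>D. k < 16 ^ D"] by (simp add: D_def)
  then have Dk: "16 ^ D \<le> 16 * k" using c by simp
  define l where "l = ln (real k)"
  have "ln 2 \<le> l" using k by (simp add: l_def)
  then have l: "1 / 2 \<le> l" using ln_2_ge_half by linarith
  define M where "M = min_max_maps k n"
  define N where "N = n div k + 1"
  have kpos: "real k > 0" using k by simp
  have "real k * 1 \<le> real k * (2 * l)" using l kpos by (intro mult_left_mono) auto
  also have "\<dots> \<le> real n" using nk by (simp add: l_def mult_ac)
  finally have n_k: "real k \<le> real n" by simp
  define x where "x = real k / real n"
  have x: "0 < x" "x \<le> 1" using n_k kpos by (auto simp: x_def)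
  have xl: "x * l \<le> 1 / 2" using nk n_k kpos by (simp add: x_def l_def field_simps)
  have xN: "x * real N \<le> 1 + x"
  proof -
    have "real (n div k) \<le> real n / real k" by (rule of_nat_div_le_of_nat)
    then have "x * real N \<le> x * (real n / real k + 1)" using x by (intro mult_left_mono) (auto simp: N_def)
    also have "\<dots> = 1 + x" using kpos n_k by (simp add: x_def field_simps)
    finally show ?thesis .
  qed
  obtain w where w: "max_maps k w = M" unfolding M_def by (rule min_max_maps_attained[of k n]) (use k in auto)
  have M1: "M \<ge> 1" using max_maps_pos[of k w] w by simp
  have ln17: "ln (17 * real k) \<le> 5 + l"
  proof -
    have "ln (17::real) \<le> ln (2 ^ 5)" by (intro ln_mono) auto
    also have "\<dots> = 5 * ln 2" by (subst ln_realpow) auto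
    finally show ?thesis using ln_2_less_1 kpos by (simp add: ln_mult l_def)
  qed
  have ln2D: "ln (2 ^ D :: real) \<le> 1 + l / 4"
  proof -
    have "4 * ln (2 ^ D :: real) = ln ((2 ^ D) ^ 4)" by (subst ln_realpow) auto
    also have "((2::real) ^ D) ^ 4 = real (16 ^ D)" by (simp add: power_mult[symmetric] mult.commute[of D] power_mult)
    also have "ln (real (16 ^ D)) \<le> ln (real (16 * k))"
    proof (rule ln_mono)
      show "real (16 ^ D) \<le> real (16 * k)" using Dk by (simp only: of_nat_le_iff)
    qed simp
    also have "\<dots> = ln (2 ^ 4) + l" using kpos by (simp add: ln_mult l_def)
    also have "ln (2 ^ 4 :: real) = 4 * ln 2" by (subst ln_realpow) auto
    finally show ?thesis using ln_2_less_1 by simp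
  qed
  have ln16: "ln (16::real) \<le> 4"
  proof -
    have "ln (16::real) = ln (2 ^ 4)" by simp
    also have "\<dots> = 4 * ln 2" by (subst ln_realpow) auto
    finally show ?thesis using ln_2_less_1 by simp
  qed
  have "M \<le> (16 ^ D + 1) ^ 3 * (16 * 2 ^ D) ^ N"
    unfolding M_def N_def using k kD by (intro min_max_maps_le) (auto simp: power_mult)
  also have "\<dots> \<le> (17 * k) ^ 3 * (16 * 2 ^ D) ^ N"
    using Dk k by (intro mult_le_mono1 power_mono) auto
  finally have "real M \<le> real ((17 * k) ^ 3 * (16 * 2 ^ D) ^ N)" by (simp only: of_nat_le_iff)
  also have "\<dots> = (17 * real k) ^ 3 * (16 * 2 ^ D) ^ N" by simp
  finally have "ln (real M) \<le> ln ((17 * real k) ^ 3 * (16 * 2 ^ D) ^ N)"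
    using M1 by (intro ln_mono) auto
  also have "\<dots> = ln ((17 * real k) ^ 3) + ln ((16 * 2 ^ D) ^ N)"
    using kpos by (intro ln_mult_pos) auto
  also have "\<dots> = 3 * ln (17 * real k) + real N * (ln 16 + ln (2 ^ D))"
  proof -
    have "ln ((17 * real k) ^ 3) = 3 * ln (17 * real k)" using kpos by (subst ln_realpow) auto
    moreover have "ln ((16 * 2 ^ D) ^ N) = real N * ln (16 * 2 ^ D :: real)" by (subst ln_realpow) auto
    moreover have "ln (16 * 2 ^ D :: real) = ln 16 + ln (2 ^ D)" by (rule ln_mult_pos) auto
    ultimately show ?thesis by simp
  qed
  also have "\<dots> \<le> 3 * (5 + l) + real N * (4 + (1 + l / 4))"
    using ln17 ln2D ln16 by (intro add_mono mult_left_mono) auto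
  finally have "x * ln (real M) \<le> x * (3 * (5 + l) + real N * (5 + l / 4))"
    using x by (intro mult_left_mono) auto
  also have "\<dots> = 15 * x + 3 * (x * l) + (x * real N) * (5 + l / 4)" by (simp add: algebra_simps)
  also have "\<dots> \<le> 15 * 1 + 3 * (1 / 2) + (1 + x) * (5 + l / 4)"
    using x xl xN l by (intro add_mono mult_left_mono mult_right_mono) auto
  also have "(1 + x) * (5 + l / 4) = 5 + l / 4 + 5 * x + (x * l) / 4" by (simp add: algebra_simps)
  \<comment> \<open>The constant terms add up to at most \<open>15 + 3 / 2 + 5 + 5 + 1 / 8\<close>,
    which is below 28.\<close>
  finally have "x * ln (real M) \<le> 28 + l / 4" using x xl by linarith
  then have "exp (x * ln (real M)) \<le> exp (28 + l / 4)" by simp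
  moreover have "exp (28 + l / 4) = exp 28 * real k powr (1/4)" using kpos by (simp add: exp_add powr_def l_def)
  moreover have "exp (x * ln (real M)) = real M powr x" using M1 by (simp add: powr_def)
  ultimately show ?thesis by (simp add: M_def x_def)
qed

theorem theorem2:
  "\<exists>C::real. C > 0 \<and>
     (\<forall>(k::nat) (n::nat). k \<ge> 2 \<and> real n \<ge> C * real k * ln (real k) \<longrightarrow>
        1 / (C * (ln (real k))\<^sup>2) * real k powr (1/4)
          \<le> real (min_max_maps k n) powr (real k / real n) \<and>
        real (min_max_maps k n) powr (real k / real n) \<le> C * real k powr (1/4))"
proof (intro exI[of _ "exp 28"] conjI allI impI)
  \<comment> \<open>\<open>exp 28\<close> is the constant of the upper bound; it also exceeds the
    \<open>exp 4\<close> of the lower bound and the factor 2 required of \<open>n\<close> in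
    both.\<close>
  show "exp 28 > (0::real)" by simp
  fix k n :: nat
  assume kn: "k \<ge> 2 \<and> real n \<ge> exp 28 * real k * ln (real k)"
  then have k: "k \<ge> 2" by simp
  have lk: "0 < ln (real k)" using k by simp
  have "2 * real k * ln (real k) \<le> exp 28 * real k * ln (real k)"
    using exp_ge_add_one_self[of 28] lk k by (intro mult_right_mono) auto
  then have nk: "real n \<ge> 2 * real k * ln (real k)" using kn by linarith
  have "1 / (exp 28 * (ln (real k))\<^sup>2) * real k powr (1/4) \<le> 1 / (exp 4 * (ln (real k))\<^sup>2) * real k powr (1/4)"
    using lk by (intro mult_right_mono divide_left_mono) auto
  also have "\<dots> \<le> real (min_max_maps k n) powr (real k / real n)" by (rule min_max_maps_lower[OF k nk])
  finally show "1 / (exp 28 * (ln (real k))\<^sup>2) * real k powr (1/4) \<le> real (min_max_maps k n) powr (real k / real n)" .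
  show "real (min_max_maps k n) powr (real k / real n) \<le> exp 28 * real k powr (1/4)"
    by (rule min_max_maps_upper[OF k nk])
qed

end
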